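(* Let $D$ be a connected acyclic digraph of order $n$ and let $cc(D)$ be the number of connected convex sets of $D$. Algorithm $\mathcal{A}$ (described in the context) correctly outputs all connected convex sets of $D$, and its time and space complexities are $O(n\cdot cc(D))$ and $O(n^2)$, respectively.
   Context: A set $X$ of vertices of an acyclic digraph $D$ is convex if $X\neq\emptyset$ and there is no directed path between two vertices of $X$ containing a vertex not in $X$; it is connected if $X\neq\emptyset$ and the underlying undirected graph of $D[X]$ is connected; a cc-set is a set that is both connected and convex. $D^{TC}$ denotes the transitive closure of $D$ (same vertices; $xy$ is an arc iff $D$ has a directed path from $x$ to $y$). For a vertex $x$, $N^+(x)$ and $N^-(x)$ are its out- and in-neighbours; for a set $X$, $N^+(X)=\bigcup_{x\in X}N^+(x)\setminus X$ and $N^-(X)=\bigcup_{x\in X}N^-(x)\setminus X$. An ordering $v_1,\dots,v_n$ is acyclic if every arc $v_iv_j$ has $i<j$. Algorithm $\mathcal{A}$: Step 1: replace $D$ by $D^{TC}$. Step 2: find an acyclic ordering $v_1,\dots,v_n$ of $D^{TC}$. Step 3: for each $i=1,\dots,n$ call $\mathcal{B}(\{v_i\},\{v_{i+1},\dots,v_n\})$. Subroutine $\mathcal{B}(X,Y)$ (all neighbourhoods taken in $D^{TC}$): let $A=N^+(X)\cap Y$. If $A\neq\emptyset$, let $v=v_j$ with $j=\max\{i: v_i\in A\}$ and $R=\{v\}\cup(N^-(v)\cap A)$. Otherwise let $B=N^-(X)\cap Y$; if $B\ne\emptyset$ let $v=v_k$ with $k=\min\{i:v_i\in B\}$ and $R=\{v\}\cup(N^+(v)\cap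 B)$. If $A=\emptyset$ and $B=\emptyset$, output $X$; otherwise call $\mathcal{B}(X\cup R, Y\setminus R)$ and then $\mathcal{B}(X, Y\setminus\{v\})$. *)

theory Defs
  imports "Graph_Theory.Graph_Theory"
begin

section \<open>Connected convex sets\<close>

definition acyclic_digraph :: "'a pair_pre_digraph \<Rightarrow> bool" where
  "acyclic_digraph D \<longleftrightarrow> pair_digraph D \<and> (\<nexists>p. pre_digraph.cycle (with_proj D) p)"

definition convex_set :: "'a pair_pre_digraph \<Rightarrow> 'a set \<Rightarrow> bool" where
  "convex_set D X \<longleftrightarrow> X \<noteq> {} \<and>
     \<not> (\<exists>u\<in>X. \<exists>v\<in>X. \<exists>p. pre_digraph.apath (with_proj D) u p v \<and>
          \<not> set (pre_digraph.awalk_verts (with_proj D) u p) \<subseteq> X)"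

text \<open>The library notion of connectedness refers to the underlying undirected graph and
  excludes the empty graph.\<close>

definition connected_set :: "'a pair_pre_digraph \<Rightarrow> 'a set \<Rightarrow> bool" where
  "connected_set D X \<longleftrightarrow> Digraph_Component.connected (with_proj D \<restriction> X)"

definition cc_sets :: "'a pair_pre_digraph \<Rightarrow> 'a set set" where
  "cc_sets D = {X. X \<subseteq> pverts D \<and> connected_set D X \<and> convex_set D X}"

definition cc :: "'a pair_pre_digraph \<Rightarrow> nat" where
  "cc D = card (cc_sets D)"


section \<open>The algorithm\<close>

definition TC :: "'a pair_pre_digraph \<Rightarrow> 'a pair_pre_digraph" where
  "TC D = \<lparr> pverts = pverts D, parcs = {(x, y). x \<rightarrow>\<^sup>+\<^bsub>with_proj D\<^esub> y} \<rparr>"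

definition out_nbrs :: "'a pair_pre_digraph \<Rightarrow> 'a \<Rightarrow> 'a set" where
  "out_nbrs D x = {y. (x, y) \<in> parcs D}"

definition in_nbrs :: "'a pair_pre_digraph \<Rightarrow> 'a \<Rightarrow> 'a set" where
  "in_nbrs D x = {y. (y, x) \<in> parcs D}"

definition out_nbrs_set :: "'a pair_pre_digraph \<Rightarrow> 'a set \<Rightarrow> 'a set" where
  "out_nbrs_set D X = (\<Union>x\<in>X. out_nbrs D x) - X"

definition in_nbrs_set :: "'a pair_pre_digraph \<Rightarrow> 'a set \<Rightarrow> 'a set" where
  "in_nbrs_set D X = (\<Union>x\<in>X. in_nbrs D x) - X"

definition acyclic_ordering :: "'a pair_pre_digraph \<Rightarrow> 'a list \<Rightarrow> bool" where
  "acyclic_ordering D vs \<longleftrightarrow> distinct vs \<and> set vs = pverts D \<and>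
     (\<forall>i < length vs. \<forall>j < length vs. (vs ! i, vs ! j) \<in> parcs D \<longrightarrow> i < j)"

definition last_in :: "'a list \<Rightarrow> 'a set \<Rightarrow> 'a" where
  "last_in vs A = vs ! Max {i. i < length vs \<and> vs ! i \<in> A}"

definition first_in :: "'a list \<Rightarrow> 'a set \<Rightarrow> 'a" where
  "first_in vs A = vs ! Min {i. i < length vs \<and> vs ! i \<in> A}"

lemma last_in_mem: "A \<noteq> {} \<Longrightarrow> A \<subseteq> set vs \<Longrightarrow> last_in vs A \<in> A"
proof -
  assume "A \<noteq> {}" "A \<subseteq> set vs"
  then obtain x where "x \<in> A" "x \<in> set vs" by blast
  then have "{i. i < length vs \<and> vs ! i \<in> A} \<noteq> {}" by (auto simp: in_set_conv_nth)
  from Max_in[OF _ this] show ?thesis by (auto simp: last_in_def)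
qed

lemma first_in_mem: "A \<noteq> {} \<Longrightarrow> A \<subseteq> set vs \<Longrightarrow> first_in vs A \<in> A"
proof -
  assume "A \<noteq> {}" "A \<subseteq> set vs"
  then obtain x where "x \<in> A" "x \<in> set vs" by blast
  then have "{i. i < length vs \<and> vs ! i \<in> A} \<noteq> {}" by (auto simp: in_set_conv_nth)
  from Min_in[OF _ this] show ?thesis by (auto simp: first_in_def)
qed

text \<open>The result is the sequence of output sets. The guard \<open>Y \<subseteq> set vs\<close> only serves to make the
  function total; it holds in every call made by \<open>alg_A\<close>.\<close>

function alg_B :: "'a pair_pre_digraph \<Rightarrow> 'a list \<Rightarrow> 'a set \<Rightarrow> 'a set \<Rightarrow> 'a set list" where
  "alg_B T vs X Y =
    (if \<not> Y \<subseteq> set vs then []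
     else let A = out_nbrs_set T X \<inter> Y; B = in_nbrs_set T X \<inter> Y in
       if A \<noteq> {} then
         let v = last_in vs A; R = {v} \<union> (in_nbrs T v \<inter> A)
         in alg_B T vs (X \<union> R) (Y - R) @ alg_B T vs X (Y - {v})
       else if B \<noteq> {} then
         let v = first_in vs B; R = {v} \<union> (out_nbrs T v \<inter> B)
         in alg_B T vs (X \<union> R) (Y - R) @ alg_B T vs X (Y - {v})
       else [X])"
  by pat_completeness auto
termination
proof -
  have *: "card (Y - R) < card Y" if "\<not> \<not> Y \<subseteq> set vs" "A = Z \<inter> Y" "A \<noteq> {}"
      "v = last_in vs A \<or> v = first_in vs A" "v \<in> R"
    for Y R A Z :: "'a set" and v :: 'a and vs :: "'a list"
  proof -
    from that have fin: "finite Y" by (auto intro: finite_subset)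
    from that have "A \<subseteq> set vs" by auto
    with that have "v \<in> A" using last_in_mem[of A vs] first_in_mem[of A vs] by metis
    with that have "v \<in> Y" by simp
    with that have "Y - R \<subset> Y" by auto
    with fin show ?thesis by (rule psubset_card_mono)
  qed
  show ?thesis
  proof (relation "measure (\<lambda>(T, vs, X, Y). card Y)", goal_cases)
    case 1 then show ?case by simp
  next
    case 2 show ?case
      by (simp only: in_measure prod.case) (rule *[OF 2(1,2,4) disjI1[OF 2(5)]], simp add: 2(6))
  next
    case 3 show ?case
      by (simp only: in_measure prod.case) (rule *[OF 3(1,2,4) disjI1[OF 3(5)]], simp)
  next
    case 4 show ?case
      by (simp only: in_measure prod.case) (rule *[OF 4(1,3,5) disjI2[OF 4(6)]], simp add: 4(7))
  next
    case 5 show ?case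
      by (simp only: in_measure prod.case) (rule *[OF 5(1,3,5) disjI2[OF 5(6)]], simp)
  qed
qed

declare alg_B.simps [simp del]

text \<open>The acyclic ordering \<open>vs\<close> of \<open>TC D\<close> is a parameter, since the algorithm may use any.\<close>

definition alg_A :: "'a pair_pre_digraph \<Rightarrow> 'a list \<Rightarrow> 'a set list" where
  "alg_A D vs =
    concat (map (\<lambda>i. alg_B (TC D) vs {vs ! i} (set (drop (Suc i) vs))) [0..<length vs])"


section \<open>Machine model\<close>

text \<open>
  A unit-cost random access machine, programmed in a while language with one recursive,
  parameterless procedure. Memory consists of cells \<open>(a, i, j)\<close>, read as entry \<open>(i, j)\<close> of the
  two-dimensional array \<open>a\<close>; a scalar \<open>a\<close> is the cell \<open>(a, 0, 0)\<close>. A cell holds a number in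
  \<open>{0..w}\<close> for a word bound \<open>w\<close>, and truth values are encoded as 0 and nonzero.
\<close>

datatype 'r exp =
    Const nat
  | Cell 'r "'r exp" "'r exp"  (\<open>_\<langle>_,_\<rangle>\<close> [1000, 0, 0] 1000)
  | Succ "'r exp"
  | Pred "'r exp"
  | Eq "'r exp" "'r exp"
  | Less "'r exp" "'r exp"
  | Neg "'r exp"
  | And "'r exp" "'r exp"
  | Or "'r exp" "'r exp"

datatype 'r com =
    Assign 'r "'r exp" "'r exp" "'r exp"  (\<open>_\<langle>_,_\<rangle> ::= _\<close> [1000, 0, 0, 61] 61)
  | Seq "'r com" "'r com"  (\<open>_;;/ _\<close> [60, 61] 60)
  | Cond "'r exp" "'r com" "'r com"  (\<open>(IF _/ THEN _/ ELSE _)\<close> [0, 0, 61] 61)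
  | While "'r exp" "'r com"  (\<open>(WHILE _/ DO _)\<close> [0, 61] 61)
  | Skip
  | Call
  | Print "'r exp"
  | Newline

type_synonym 'r cell = "'r \<times> nat \<times> nat"
type_synonym 'r store = "'r cell \<Rightarrow> nat"

fun eval :: "'r exp \<Rightarrow> 'r store \<Rightarrow> nat" where
  "eval (Const k) s = k"
| "eval (Cell a i j) s = s (a, eval i s, eval j s)"
| "eval (Succ e) s = Suc (eval e s)"
| "eval (Pred e) s = eval e s - 1"
| "eval (Eq e f) s = of_bool (eval e s = eval f s)"
| "eval (Less e f) s = of_bool (eval e s < eval f s)"
| "eval (Neg e) s = of_bool (eval e s = 0)"
| "eval (And e f) s = of_bool (eval e s \<noteq> 0 \<and> eval f s \<noteq> 0)"
| "eval (Or e f) s = of_bool (eval e s \<noteq> 0 \<or> eval f s \<noteq> 0)"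

fun cells_read :: "'r exp \<Rightarrow> 'r store \<Rightarrow> 'r cell set" where
  "cells_read (Const k) s = {}"
| "cells_read (Cell a i j) s =
    insert (a, eval i s, eval j s) (cells_read i s \<union> cells_read j s)"
| "cells_read (Succ e) s = cells_read e s"
| "cells_read (Pred e) s = cells_read e s"
| "cells_read (Eq e f) s = cells_read e s \<union> cells_read f s"
| "cells_read (Less e f) s = cells_read e s \<union> cells_read f s"
| "cells_read (Neg e) s = cells_read e s"
| "cells_read (And e f) s = cells_read e s \<union> cells_read f s"
| "cells_read (Or e f) s = cells_read e s \<union> cells_read f s"

fun ops :: "'r exp \<Rightarrow> nat" where
  "ops (Const k) = 1"
| "ops (Cell a i j) = 1 + ops i + ops j"
| "ops (Succ e) = 1 + ops e"
| "ops (Pred e) = 1 + ops e"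
| "ops (Eq e f) = 1 + ops e + ops f"
| "ops (Less e f) = 1 + ops e + ops f"
| "ops (Neg e) = 1 + ops e"
| "ops (And e f) = 1 + ops e + ops f"
| "ops (Or e f) = 1 + ops e + ops f"

text \<open>
  \<open>exec w body c s s' out t U d\<close>: with word bound \<open>w\<close> and procedure body \<open>body\<close>, command \<open>c\<close>
  started in \<open>s\<close> terminates in \<open>s'\<close> and writes \<open>out\<close> to the write-only output (\<open>Some k\<close> is a
  printed number, \<open>None\<close> a newline); it takes \<open>t\<close> elementary operations, accesses exactly the
  cells \<open>U\<close>, and \<open>d\<close> is the maximal number of simultaneously pending calls.
\<close>

inductive exec :: "nat \<Rightarrow> 'r com \<Rightarrow> 'r com \<Rightarrow> 'r store \<Rightarrow> 'r store \<Rightarrow> nat option list \<Rightarrow>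
    nat \<Rightarrow> 'r cell set \<Rightarrow> nat \<Rightarrow> bool"
  for w :: nat and body :: "'r com"
where
  Assign: "eval e s \<le> w \<Longrightarrow>
    exec w body (a\<langle>i,j\<rangle> ::= e) s (s((a, eval i s, eval j s) := eval e s)) []
      (1 + ops i + ops j + ops e)
      (insert (a, eval i s, eval j s) (cells_read i s \<union> cells_read j s \<union> cells_read e s)) 0"
| Seq: "exec w body c1 s1 s2 out1 t1 U1 d1 \<Longrightarrow> exec w body c2 s2 s3 out2 t2 U2 d2 \<Longrightarrow>
    exec w body (c1;; c2) s1 s3 (out1 @ out2) (t1 + t2) (U1 \<union> U2) (max d1 d2)"
| IfTrue: "eval b s \<noteq> 0 \<Longrightarrow> exec w body c1 s s' out t U d \<Longrightarrow>
    exec w body (IF b THEN c1 ELSE c2) s s' out (1 + ops b + t) (cells_read b s \<union> U) d"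
| IfFalse: "eval b s = 0 \<Longrightarrow> exec w body c2 s s' out t U d \<Longrightarrow>
    exec w body (IF b THEN c1 ELSE c2) s s' out (1 + ops b + t) (cells_read b s \<union> U) d"
| WhileFalse: "eval b s = 0 \<Longrightarrow>
    exec w body (WHILE b DO c) s s [] (1 + ops b) (cells_read b s) 0"
| WhileTrue: "eval b s1 \<noteq> 0 \<Longrightarrow> exec w body c s1 s2 out1 t1 U1 d1 \<Longrightarrow>
    exec w body (WHILE b DO c) s2 s3 out2 t2 U2 d2 \<Longrightarrow>
    exec w body (WHILE b DO c) s1 s3 (out1 @ out2) (1 + ops b + t1 + t2)
      (cells_read b s1 \<union> U1 \<union> U2) (max d1 d2)"
| Skip: "exec w body Skip s s [] 1 {} 0"
| Call: "exec w body body s s' out t U d \<Longrightarrow> exec w body Call s s' out (1 + t) U (Suc d)"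
| Print: "exec w body (Print e) s s [Some (eval e s)] (1 + ops e) (cells_read e s) 0"
| Newline: "exec w body Newline s s [None] 1 {} 0"

lemma finite_cells_read: "finite (cells_read e s)"
  by (induction e) auto

lemma exec_finite: "exec w body c s s' out t U d \<Longrightarrow> finite U"
  by (induction rule: exec.induct) (auto simp: finite_cells_read)

lemma exec_det: "exec w body c s s' out t U d \<Longrightarrow> exec w body c s s'' out' t' U' d' \<Longrightarrow>
  s' = s'' \<and> out = out' \<and> t = t' \<and> U = U' \<and> d = d'"
proof (induction arbitrary: s'' out' t' U' d' rule: exec.induct)
  case (WhileTrue b s1 c s2 out1 t1 U1 d1 s3 out2 t2 U2 d2)
  from WhileTrue.prems show ?case using WhileTrue.hyps(1) WhileTrue.IH
    by (cases rule: exec.cases) blast+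
next
  case (Seq c1 s1 s2 out1 t1 U1 d1 c2 s3 out2 t2 U2 d2)
  from Seq.prems show ?case using Seq.IH by (cases rule: exec.cases) blast+
next
  case (Call s s' out t U d)
  from Call.prems show ?case using Call.IH by (cases rule: exec.cases) blast+
next
  case (IfTrue b s c1 s' out t U d c2)
  from IfTrue.prems show ?case using IfTrue.hyps(1) IfTrue.IH by (cases rule: exec.cases) blast+
next
  case (IfFalse b s c1 s' out t U d c2)
  from IfFalse.prems show ?case using IfFalse.hyps(1) IfFalse.IH by (cases rule: exec.cases) blast+
qed (auto elim: exec.cases)

abbreviation Scalar :: "'r \<Rightarrow> 'r exp"  (\<open>\<section>_\<close> [1000] 1000) where
  "\<section>a \<equiv> Cell a (Const 0) (Const 0)"

abbreviation Assign_Scalar :: "'r \<Rightarrow> 'r exp \<Rightarrow> 'r com"  (\<open>\<section>_ ::= _\<close> [1000, 61] 61) where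
  "\<section>a ::= e \<equiv> Assign a (Const 0) (Const 0) e"

definition For :: "'r \<Rightarrow> 'r exp \<Rightarrow> 'r com \<Rightarrow> 'r com"  (\<open>(FOR _ BELOW _/ DO _)\<close> [1000, 0, 61] 61) where
  "FOR i BELOW e DO c = (\<section>i ::= Const 0;; WHILE Less (\<section>i) e DO (c;; \<section>i ::= Succ (\<section>i)))"


section \<open>Implementation of the algorithm\<close>

text \<open>
  The vertices are numbered \<open>0, \<dots>, n - 1\<close>. \<open>Adj\<close> is the adjacency matrix and \<open>Ord\<close> the acyclic
  ordering. The subroutine works with positions in \<open>Ord\<close>: at recursion level \<open>Lev\<close>, row \<open>Lev\<close> of
  \<open>ArrX\<close>, \<open>ArrY\<close>, \<open>ArrA\<close>, \<open>ArrB\<close> holds the characteristic vectors of the arguments \<open>X\<close>, \<open>Y\<close> and of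
  \<open>A\<close> and \<open>B\<close>, and entry \<open>Lev\<close> of \<open>ArrV\<close> holds the position of \<open>v\<close>.
\<close>

datatype reg = Num | Adj | Deg | Ord | Cnt | Lev | ArrX | ArrY | ArrA | ArrB | ArrV | I | J | K | S

abbreviation ord_arc :: "reg exp \<Rightarrow> reg exp \<Rightarrow> reg exp" where
  "ord_arc i j \<equiv> Adj\<langle>Ord\<langle>i, Const 0\<rangle>, Ord\<langle>j, Const 0\<rangle>\<rangle>"

abbreviation cur_v :: "reg exp" where
  "cur_v \<equiv> ArrV\<langle>\<section>Lev, Const 0\<rangle>"

definition step1 :: "reg com" where
  "step1 =
    (FOR K BELOW \<section>Num DO FOR I BELOW \<section>Num DO FOR J BELOW \<section>Num DO
       IF And (Adj\<langle>\<section>I, \<section>K\<rangle>) (Adj\<langle>\<section>K, \<section>J\<rangle>) THEN Adj\<langle>\<section>I, \<section>J\<rangle> ::= Const 1 ELSE Skip)"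

text \<open>In a transitive acyclic digraph, sorting the vertices by in-degree gives an acyclic
  ordering.\<close>

definition step2 :: "reg com" where
  "step2 =
    (FOR J BELOW \<section>Num DO
      (Deg\<langle>\<section>J, Const 0\<rangle> ::= Const 0;;
       FOR I BELOW \<section>Num DO
         IF Adj\<langle>\<section>I, \<section>J\<rangle> THEN Deg\<langle>\<section>J, Const 0\<rangle> ::= Succ (Deg\<langle>\<section>J, Const 0\<rangle>) ELSE Skip);;
     \<section>Cnt ::= Const 0;;
     FOR K BELOW \<section>Num DO FOR J BELOW \<section>Num DO
       IF Eq (Deg\<langle>\<section>J, Const 0\<rangle>) (\<section>K)
       THEN (Ord\<langle>\<section>Cnt, Const 0\<rangle> ::= \<section>J;; \<section>Cnt ::= Succ (\<section>Cnt))
       ELSE Skip)"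

text \<open>\<open>A\<close> and \<open>B\<close> are updated rather than recomputed. By transitivity, passing from \<open>X\<close> to
  \<open>X \<union> R\<close> adds no out-neighbours if \<open>R \<subseteq> N\<^sup>+(X)\<close>, and the only new in-neighbours are those of \<open>v\<close>;
  dually for \<open>R \<subseteq> N\<^sup>-(X)\<close>.\<close>

definition branch :: "(reg exp \<Rightarrow> reg exp) \<Rightarrow> (reg exp \<Rightarrow> reg exp) \<Rightarrow>
    (reg exp \<Rightarrow> reg exp) \<Rightarrow> reg com" where
  "branch inR newA newB =
    (FOR I BELOW \<section>Num DO
      (ArrX\<langle>Succ (\<section>Lev), \<section>I\<rangle> ::= Or (ArrX\<langle>\<section>Lev, \<section>I\<rangle>) (inR (\<section>I));;
       ArrY\<langle>Succ (\<section>Lev), \<section>I\<rangle> ::= And (ArrY\<langle>\<section>Lev, \<section>I\<rangle>) (Neg (inR (\<section>I)));;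
       ArrA\<langle>Succ (\<section>Lev), \<section>I\<rangle> ::= And (ArrY\<langle>Succ (\<section>Lev), \<section>I\<rangle>) (newA (\<section>I));;
       ArrB\<langle>Succ (\<section>Lev), \<section>I\<rangle> ::= And (ArrY\<langle>Succ (\<section>Lev), \<section>I\<rangle>) (newB (\<section>I)));;
     \<section>Lev ::= Succ (\<section>Lev);; Call;; \<section>Lev ::= Pred (\<section>Lev);;
     ArrY\<langle>\<section>Lev, cur_v\<rangle> ::= Const 0;;
     ArrA\<langle>\<section>Lev, cur_v\<rangle> ::= Const 0;;
     ArrB\<langle>\<section>Lev, cur_v\<rangle> ::= Const 0;;
     Call)"

definition subroutine_B :: "reg com" where
  "subroutine_B =
    (ArrV\<langle>\<section>Lev, Const 0\<rangle> ::= \<section>Num;;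
     FOR I BELOW \<section>Num DO
       IF ArrA\<langle>\<section>Lev, \<section>I\<rangle> THEN ArrV\<langle>\<section>Lev, Const 0\<rangle> ::= \<section>I ELSE Skip;;
     IF Less cur_v (\<section>Num)
     THEN branch
       (\<lambda>i. Or (Eq i cur_v) (And (ArrA\<langle>\<section>Lev, i\<rangle>) (ord_arc i cur_v)))
       (\<lambda>i. ArrA\<langle>\<section>Lev, i\<rangle>)
       (\<lambda>i. Or (ArrB\<langle>\<section>Lev, i\<rangle>) (ord_arc i cur_v))
     ELSE
      (FOR I BELOW \<section>Num DO
         IF And (ArrB\<langle>\<section>Lev, \<section>I\<rangle>) (Eq cur_v (\<section>Num))
         THEN ArrV\<langle>\<section>Lev, Const 0\<rangle> ::= \<section>I ELSE Skip;;
       IF Less cur_v (\<section>Num)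
       THEN branch
         (\<lambda>i. Or (Eq i cur_v) (And (ArrB\<langle>\<section>Lev, i\<rangle>) (ord_arc cur_v i)))
         (\<lambda>i. Or (ArrA\<langle>\<section>Lev, i\<rangle>) (ord_arc cur_v i))
         (\<lambda>i. ArrB\<langle>\<section>Lev, i\<rangle>)
       ELSE
        (FOR I BELOW \<section>Num DO
           IF ArrX\<langle>\<section>Lev, \<section>I\<rangle> THEN Print (Ord\<langle>\<section>I, Const 0\<rangle>) ELSE Skip;;
         Newline)))"

definition step3 :: "reg com" where
  "step3 =
    (FOR S BELOW \<section>Num DO
      (\<section>Lev ::= Const 0;;
       FOR I BELOW \<section>Num DO
        (ArrX\<langle>Const 0, \<section>I\<rangle> ::= Eq (\<section>I) (\<section>S);;
         ArrY\<langle>Const 0, \<section>I\<rangle> ::= Less (\<section>S) (\<section>I);;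
         ArrA\<langle>Const 0, \<section>I\<rangle> ::= And (ArrY\<langle>Const 0, \<section>I\<rangle>) (ord_arc (\<section>S) (\<section>I));;
         ArrB\<langle>Const 0, \<section>I\<rangle> ::= And (ArrY\<langle>Const 0, \<section>I\<rangle>) (ord_arc (\<section>I) (\<section>S)));;
       Call))"

definition algorithm_A :: "reg com" where
  "algorithm_A = (step1;; step2;; step3)"

text \<open>The input: the order of the digraph and its adjacency matrix with respect to an
  enumeration \<open>us\<close> of the vertices.\<close>

definition input :: "'a pair_pre_digraph \<Rightarrow> 'a list \<Rightarrow> reg store" where
  "input D us = (\<lambda>(a, i, j).
     if a = Num \<and> i = 0 \<and> j = 0 then length us
     else if a = Adj \<and> i < length us \<and> j < length us \<and> (us ! i, us ! j) \<in> parcs D then 1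
     else 0)"

definition printed :: "nat list list \<Rightarrow> nat option list" where
  "printed ls = concat (map (\<lambda>l. map Some l @ [None]) ls)"

text \<open>On input \<open>D\<close>, the program prints the sequence \<open>Xs\<close> of vertex sets in time \<open>t\<close> and
  space \<open>m\<close>. Words range over \<open>{0..n}\<close>; space counts all cells accessed, including the input,
  and one return address for each pending call, but not the output.\<close>

definition algorithm_A_run ::
    "'a pair_pre_digraph \<Rightarrow> 'a list \<Rightarrow> 'a set list \<Rightarrow> nat \<Rightarrow> nat \<Rightarrow> bool" where
  "algorithm_A_run D us Xs t m \<longleftrightarrow>
     (\<exists>s' ls U d.
        exec (length us) subroutine_B algorithm_A (input D us) s' (printed ls) t U d \<and>
        Xs = map (\<lambda>l. (!) us ` set l) ls \<and>
        m = card U + d)"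

end

theory Submission
  imports Defs
begin

text \<open>
  In terms of the strict order \<open>r = parcs (TC D)\<close>, the cc-sets of \<open>D\<close> are the order-convex sets whose
  comparability graph is connected. The subroutine keeps \<open>X\<close> a cc-set and \<open>X \<union> Y\<close> convex: every
  cc-set that contains \<open>X\<close> and \<open>v\<close> contains \<open>R\<close>, and since \<open>v\<close> is extremal in \<open>N\<^sup>+(X) \<inter> Y\<close>
  (or \<open>N\<^sup>-(X) \<inter> Y\<close>), deleting it from \<open>Y\<close> preserves convexity. So a call enumerates exactly once
  each cc-set between \<open>X\<close> and \<open>X \<union> Y\<close>.

  The recursion is a binary tree whose leaves are the outputs, and a call costs \<open>O(n)\<close> apart from its
  recursive calls. The remaining \<open>O(n\<^sup>3)\<close> for the transitive closure is absorbed by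
  \<open>n (n + 1) / 2 \<le> cc(D)\<close>: every cc-set inside another one can be enlarged by one vertex at a time, so
  some vertex \<open>x\<close> can be deleted leaving a cc-set, and there are at least \<open>n\<close> cc-sets containing \<open>x\<close>,
  one for each size.
\<close>

section \<open>Connected convex sets of a strict order\<close>

text \<open>Linear cost per call leaves no time to collect \<open>A\<close> and \<open>B\<close>
  from the matrix in every call. The machine invariant therefore carries both sets exactly, and
  their linear-time update has to be justified by transitivity. Time is charged to outputs through a
  potential: a call with \<open>k\<close> outputs takes at most
  \<open>4000 * n * k - 2000 * n\<close> operations. Summing this over two recursive calls leaves
  \<open>2000 * n\<close> spare operations for the parent, so a bound proportional to the number of
  leaves survives the induction. Space is controlled by the level plus the size of \<open>Y\<close>,
  which stays below \<open>n\<close>: entering a deeper level removes at least one vertex from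
  \<open>Y\<close>. The order lemmas are stated for an abstract relation \<open>r\<close>, so that
  the in-neighbour case is the out-neighbour case of \<open>r\<inverse>\<close>. The program
  determines its own ordering, by in-degree, whereas the recursion is proved correct for every
  acyclic ordering.\<close>

definition link :: "'a rel \<Rightarrow> 'a set \<Rightarrow> 'a rel" where
  "link r X = (r \<union> r\<inverse>) \<inter> X \<times> X"

text \<open>A single intermediate vertex stands for a whole path, since \<open>r\<close> is going to
  be a transitive closure. Nonemptiness is left to \<open>link_connected\<close>, so that remainders
  such as \<open>P - {v}\<close> need no side condition.\<close>

definition order_convex :: "'a rel \<Rightarrow> 'a set \<Rightarrow> bool" where
  "order_convex r X \<longleftrightarrow> (\<forall>x\<in>X. \<forall>z\<in>X. \<forall>y. (x, y) \<in> r \<longrightarrow> (y, z) \<in> r \<longrightarrow> y \<in> X)"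

definition link_connected :: "'a rel \<Rightarrow> 'a set \<Rightarrow> bool" where
  "link_connected r X \<longleftrightarrow> X \<noteq> {} \<and> X \<times> X \<subseteq> (link r X)\<^sup>*"

definition cc_rel :: "'a rel \<Rightarrow> 'a set \<Rightarrow> bool" where
  "cc_rel r X \<longleftrightarrow> link_connected r X \<and> order_convex r X"

lemma order_convexD:
  "order_convex r X \<Longrightarrow> x \<in> X \<Longrightarrow> z \<in> X \<Longrightarrow> (x, y) \<in> r \<Longrightarrow> (y, z) \<in> r \<Longrightarrow> y \<in> X"
  unfolding order_convex_def by blast

lemma link_mono: "X \<subseteq> Y \<Longrightarrow> link r X \<subseteq> link r Y"
  unfolding link_def by auto

lemma link_converse: "link (r\<inverse>) X = link r X"
  unfolding link_def by auto

text \<open>The duality that turns statements about out-neighbours into statements about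
  in-neighbours: both conditions are symmetric under reversing \<open>r\<close>.\<close>

lemma cc_rel_converse: "cc_rel (r\<inverse>) X = cc_rel r X"
  unfolding cc_rel_def link_connected_def order_convex_def link_converse by auto

lemma sym_link: "sym (link r X)"
  unfolding link_def sym_def by auto

lemma link_connected_Un:
  assumes X: "link_connected r X" and R: "\<And>y. y \<in> R \<Longrightarrow> \<exists>x\<in>X. (x, y) \<in> r \<union> r\<inverse>"
  shows "link_connected r (X \<union> R)"
proof -
  let ?L = "(link r (X \<union> R))\<^sup>*"
  obtain x0 where x0: "x0 \<in> X" using X unfolding link_connected_def by auto
  have inX: "(x0, x) \<in> ?L" if "x \<in> X" for x
    using X x0 that rtrancl_mono[OF link_mono[of X "X \<union> R" r]] unfolding link_connected_def by blast
  have all: "(x0, y) \<in> ?L" if y: "y \<in> X \<union> R" for y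
  proof (cases "y \<in> X")
    case False
    with y obtain x where x: "x \<in> X" "(x, y) \<in> r \<union> r\<inverse>" using R[of y] by auto
    then have "(x, y) \<in> link r (X \<union> R)" using y unfolding link_def by auto
    with inX[OF x(1)] show ?thesis by (rule rtrancl_into_rtrancl)
  qed (rule inX)
  have "(y, z) \<in> ?L" if "y \<in> X \<union> R" "z \<in> X \<union> R" for y z
    using all[OF that(1)] all[OF that(2)] sym_rtrancl[OF sym_link[of r "X \<union> R"]]
    by (meson rtrancl_trans symD)
  then show ?thesis using x0 unfolding link_connected_def by auto
qed

text \<open>A walk in \<open>Z\<close> from inside \<open>X\<close> to outside must use an edge that
  leaves \<open>X\<close>; the induction follows the walk.\<close>

lemma link_connected_exit:
  assumes Z: "link_connected r Z" and "X \<subset> Z" "X \<noteq> {}"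
  obtains x y where "x \<in> X" "y \<in> Z - X" "(x, y) \<in> r \<union> r\<inverse>"
proof -
  obtain a b where ab: "a \<in> X" "b \<in> Z - X" using assms by auto
  then have "(a, b) \<in> (link r Z)\<^sup>*" using assms unfolding link_connected_def by auto
  then have "b \<in> X \<or> (\<exists>x\<in>X. \<exists>y\<in>Z - X. (x, y) \<in> r \<union> r\<inverse>)"
  proof (induction rule: rtrancl_induct)
    case (step y z)
    then show ?case unfolding link_def by blast
  qed (simp add: ab)
  then show ?thesis using ab that by auto
qed

text \<open>Used twice: it supplies a vertex towards which a cc-set can grow, and it shows that a
  call without neighbours in \<open>Y\<close> has nothing to enumerate but \<open>X\<close>.\<close>

lemma cc_rel_exit:
  assumes "cc_rel r X" "cc_rel r Z" "X \<subset> Z"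
  obtains y where "y \<in> Z - X" "y \<in> r `` X \<union> r\<inverse> `` X"
proof -
  have "link_connected r Z" "X \<noteq> {}" using assms unfolding cc_rel_def link_connected_def by auto
  then obtain x y where "x \<in> X" "y \<in> Z - X" "(x, y) \<in> r \<union> r\<inverse>"
    using link_connected_exit[of r Z X] assms(3) by metis
  then show ?thesis using that by blast
qed

text \<open>With \<open>P = X \<union> Y\<close> convex and \<open>A = N\<^sup>+(X) \<inter> Y\<close>, this covers both the set \<open>R\<close> of the algorithm and
  the extension of \<open>X\<close> by a single minimal element of \<open>A\<close>.\<close>

lemma cc_rel_extend:
  assumes "trans r" "cc_rel r X" "order_convex r P" "X \<union> R \<subseteq> P"
    and R: "R \<subseteq> r `` X - X"
    and down: "\<And>u z. z \<in> R \<Longrightarrow> (u, z) \<in> r \<Longrightarrow> u \<in> r `` X \<Longrightarrow> u \<in> P \<Longrightarrow> u \<in> X \<union> R"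
  shows "cc_rel r (X \<union> R)"
proof -
  have X: "link_connected r X" "order_convex r X" using assms(2) by (auto simp: cc_rel_def)
  have "link_connected r (X \<union> R)"
    using R by (intro link_connected_Un[OF X(1)]) auto
  moreover have "order_convex r (X \<union> R)"
    unfolding order_convex_def
  proof (intro ballI allI impI)
    fix a z y assume a: "a \<in> X \<union> R" and z: "z \<in> X \<union> R" and r: "(a, y) \<in> r" "(y, z) \<in> r"
    have P: "y \<in> P" using order_convexD[OF assms(3) _ _ r] a z assms(4) by auto
    \<comment> \<open>\<open>R\<close> lies above \<open>X\<close>, so an arc into \<open>y\<close>
      from \<open>R\<close> can be replaced by one from \<open>X\<close>. Thus \<open>y\<close> is a
      successor of a vertex of \<open>X\<close>, and only the endpoint \<open>z\<close> needs a case
      distinction.\<close>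
    have "\<exists>x\<in>X. x = a \<or> (x, a) \<in> r" using a R by auto
    then obtain x where x: "x \<in> X" "(x, y) \<in> r" using r(1) \<open>trans r\<close> by (auto dest: transD)
    show "y \<in> X \<union> R"
    proof (cases "z \<in> X")
      case True
      then show ?thesis using order_convexD[OF X(2) x(1) True x(2) r(2)] by simp
    next
      case False
      then show ?thesis using down[OF _ r(2) _ P] x z by auto
    qed
  qed
  ultimately show ?thesis by (simp add: cc_rel_def)
qed

text \<open>Deleting \<open>v\<close> can only hurt if \<open>v\<close> lies between some
  \<open>a\<close> and \<open>b\<close> of \<open>P\<close>. Then \<open>b\<close> is above
  \<open>v\<close>, hence above \<open>X\<close>, hence in \<open>X\<close> by \<open>up\<close>; so
  \<open>v\<close> lies between two vertices of \<open>X\<close>, and convexity of \<open>X\<close>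
  puts it into \<open>X\<close>.\<close>

lemma order_convex_remove:
  assumes "trans r" "order_convex r X" "order_convex r P" "X \<subseteq> P"
    and v: "v \<in> r `` X - X"
    and up: "\<And>b. (v, b) \<in> r \<Longrightarrow> b \<in> r `` X \<Longrightarrow> b \<in> P \<Longrightarrow> b \<in> X"
  shows "order_convex r (P - {v})"
  unfolding order_convex_def
proof (intro ballI allI impI)
  fix a b y assume a: "a \<in> P - {v}" and b: "b \<in> P - {v}" and r: "(a, y) \<in> r" "(y, b) \<in> r"
  have P: "y \<in> P" using order_convexD[OF assms(3) _ _ r] a b by auto
  moreover have "y \<noteq> v"
  proof
    assume yv: "y = v"
    obtain x where x: "x \<in> X" "(x, v) \<in> r" using v by auto
    then have "b \<in> r `` X" using r yv \<open>trans r\<close> by (auto dest: transD)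
    then have "b \<in> X" using up r b yv by auto
    then have "v \<in> X" using order_convexD[OF assms(2) x(1) _ x(2)] r yv by auto
    then show False using v by simp
  qed
  ultimately show "y \<in> P - {v}" by simp
qed

lemma cc_rel_singleton: "irrefl r \<Longrightarrow> trans r \<Longrightarrow> cc_rel r {x}"
  unfolding cc_rel_def link_connected_def order_convex_def by (auto dest: transD simp: irrefl_def)

section \<open>Growing cc-sets by single vertices, and counting them\<close>

lemma acyclic_trans: "irrefl r \<Longrightarrow> trans r \<Longrightarrow> acyclic r"
  by (simp add: acyclic_irrefl)

lemma finite_minimal:
  assumes "irrefl r" "trans r" "finite A" "A \<noteq> {}"
  obtains v where "v \<in> A" "\<And>u. u \<in> A \<Longrightarrow> (u, v) \<notin> r"
proof -
  have "wf (r \<inter> A \<times> A)"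
    using assms acyclic_subset[OF acyclic_trans[OF assms(1,2)]]
    by (intro finite_acyclic_wf) auto
  then obtain v where "v \<in> A" "\<And>u. (u, v) \<in> r \<inter> A \<times> A \<Longrightarrow> u \<notin> A"
    using wfE_min'[OF _ assms(4)] by metis
  then show ?thesis using that by blast
qed

text \<open>Some neighbour of \<open>X\<close> lies in \<open>Z - X\<close>. If it is an
  out-neighbour, a minimal such vertex can be added alone: whatever lies between \<open>X\<close>
  and it is in \<open>Z\<close> by convexity, and by minimality already in \<open>X\<close>. The
  other case is the same argument for \<open>r\<inverse>\<close>, which is why the local claim is
  made for any \<open>q\<close>.\<close>

lemma cc_rel_extend_one:
  assumes r: "irrefl r" "trans r" and "finite Z" "cc_rel r X" "cc_rel r Z" "X \<subset> Z"
  obtains v where "v \<in> Z - X" "cc_rel r (insert v X)"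
proof -
  have ext: "\<exists>v\<in>Z - X. cc_rel q (insert v X)"
    if q: "irrefl q" "trans q" "cc_rel q X" "cc_rel q Z" "q `` X \<inter> (Z - X) \<noteq> {}" for q
  proof -
    obtain v where v: "v \<in> q `` X \<inter> (Z - X)"
      and min: "\<And>u. u \<in> q `` X \<inter> (Z - X) \<Longrightarrow> (u, v) \<notin> q"
      using finite_minimal[OF q(1,2) _ q(5)] assms(3) by auto
    have "cc_rel q (X \<union> {v})"
      by (rule cc_rel_extend[where P = Z])
        (use q v assms(6) min in \<open>auto simp: cc_rel_def[of q Z] simp del: Image_iff\<close>)
    then show ?thesis using v by auto
  qed
  obtain y where y: "y \<in> Z - X" "y \<in> r `` X \<union> r\<inverse> `` X"
    using cc_rel_exit[OF assms(4-6)] by metis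
  have "irrefl (r\<inverse>)" "trans (r\<inverse>)" using r by (auto simp: irrefl_def)
  then show ?thesis using y ext[of r] ext[of "r\<inverse>"] assms that by (auto simp: cc_rel_converse)
qed

lemma cc_rel_chain:
  assumes r: "irrefl r" "trans r" and "finite Z" "cc_rel r Z" "x \<in> Z"
    and "0 < k" "k \<le> card Z"
  shows "\<exists>X. x \<in> X \<and> X \<subseteq> Z \<and> cc_rel r X \<and> card X = k"
  using assms(6,7)
proof (induction k rule: nat_induct_non_zero)
  case 1
  show ?case using cc_rel_singleton[OF r] assms by (intro exI[of _ "{x}"]) auto
next
  case (Suc k)
  then obtain X where X: "x \<in> X" "X \<subseteq> Z" "cc_rel r X" "card X = k" by auto
  then have "X \<subset> Z" using Suc.prems by auto
  then obtain v where "v \<in> Z - X" "cc_rel r (insert v X)"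
    using cc_rel_extend_one[OF r assms(3) X(3) assms(4)] by metis
  then show ?case using X finite_subset[OF X(2) assms(3)] by (intro exI[of _ "insert v X"]) auto
qed

text \<open>Adding the vertex \<open>x\<close> to a cc-set of size \<open>m\<close> contributes at
  least \<open>m + 1\<close> new cc-sets, which sums to a triangular number; it is doubled to avoid
  a division. A chain, whose cc-sets are its nonempty intervals, attains the bound.\<close>

lemma card_cc_rel_ge:
  assumes r: "irrefl r" "trans r" and "finite Z" "cc_rel r Z"
  shows "card Z * (card Z + 1) \<le> 2 * card {X. X \<subseteq> Z \<and> cc_rel r X}"
  using assms(3,4)
proof (induction "card Z" arbitrary: Z)
  case 0
  then show ?case by simp
next
  case (Suc m)
  let ?C = "{X. X \<subseteq> Z \<and> cc_rel r X}"
  have fin: "finite ?C" using Suc by auto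
  \<comment> \<open>A cc-set of size \<open>m\<close> inside \<open>Z\<close> exhibits a vertex whose deletion leaves a cc-set.\<close>
  obtain x where x: "x \<in> Z" and m: "m = 0 \<or> cc_rel r (Z - {x})"
  proof (cases "m = 0")
    case True
    then show ?thesis using that Suc by (metis card.empty ex_in_conv old.nat.distinct(2))
  next
    case False
    obtain z where "z \<in> Z" using Suc by (metis card.empty ex_in_conv old.nat.distinct(2))
    then obtain X where X: "X \<subseteq> Z" "cc_rel r X" "card X = m"
      using cc_rel_chain[OF r Suc.prems, of z m] False Suc by auto
    then have "card (Z - X) = 1" using Suc by (simp add: card_Diff_subset finite_subset)
    then obtain x where "Z - X = {x}" by (auto simp: card_1_singleton_iff)
    then have "x \<in> Z" "Z - {x} = X" using X by auto
    then show ?thesis using that X by metis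
  qed
  let ?Del = "{X. X \<subseteq> Z - {x} \<and> cc_rel r X}" and ?Keep = "{X. x \<in> X \<and> X \<subseteq> Z \<and> cc_rel r X}"
  have "k \<in> card ` ?Keep" if k: "k \<in> {1..Suc m}" for k
  proof -
    obtain X where "x \<in> X" "X \<subseteq> Z" "cc_rel r X" "card X = k"
      using cc_rel_chain[OF r Suc.prems x, of k] Suc.hyps(2) k by auto
    then show ?thesis by (intro image_eqI[of _ _ X]) simp_all
  qed
  then have "{1..Suc m} \<subseteq> card ` ?Keep" by (rule subsetI)
  moreover have fin1: "finite ?Keep" and fin0: "finite ?Del" by (rule finite_subset[OF _ fin], blast)+
  ultimately have Keep: "Suc m \<le> card ?Keep"
    using surj_card_le[of ?Keep "{1..Suc m}" card] by simp
  have card: "card (Z - {x}) = m" using Suc x by simp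
  \<comment> \<open>For \<open>m = 0\<close> the set \<open>Z - {x}\<close> is empty, hence no
    cc-set, and the induction hypothesis cannot be applied; the claim is then trivial.\<close>
  have "m * (m + 1) \<le> 2 * card ?Del"
  proof (cases "m = 0")
    case False
    then show ?thesis using m Suc(1)[of "Z - {x}"] card Suc.prems(1) by simp
  qed simp
  moreover have "?C = ?Del \<union> ?Keep" "?Del \<inter> ?Keep = {}" by blast+
  then have "card ?C = card ?Del + card ?Keep" using card_Un_disjoint[OF fin0 fin1] by simp
  ultimately show ?case using Keep Suc.hyps(2)[symmetric] by (simp add: algebra_simps)
qed

subsection \<open>Correctness of the recursion\<close>

definition B_inv :: "'a rel \<Rightarrow> 'a set \<Rightarrow> 'a set \<Rightarrow> bool" where
  "B_inv r X Y \<longleftrightarrow> cc_rel r X \<and> order_convex r (X \<union> Y) \<and> X \<inter> Y = {}"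

lemma B_inv_converse: "B_inv (r\<inverse>) X Y = B_inv r X Y"
  unfolding B_inv_def cc_rel_converse by (auto simp: order_convex_def)

text \<open>\<open>R\<close> is what convexity forces when \<open>v\<close> joins \<open>X\<close>:
  the vertices of \<open>A\<close> below \<open>v\<close> lie between \<open>X\<close> and
  \<open>v\<close>. This gives the third claim and, since everything below \<open>R\<close> is below
  \<open>v\<close>, also the first. Maximality of \<open>v\<close> serves the second claim, through
  \<open>order_convex_remove\<close>.\<close>

lemma B_inv_step:
  assumes "trans r" and inv: "B_inv r X Y" and A: "A = (r `` X - X) \<inter> Y"
    and v: "v \<in> A" and max: "\<And>b. b \<in> A \<Longrightarrow> (v, b) \<notin> r"
    and R: "R = {v} \<union> (r\<inverse> `` {v} \<inter> A)"
  shows "B_inv r (X \<union> R) (Y - R)" and "B_inv r X (Y - {v})"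
    and "\<And>Z. cc_rel r Z \<Longrightarrow> X \<subseteq> Z \<Longrightarrow> v \<in> Z \<Longrightarrow> R \<subseteq> Z"
proof -
  have X: "cc_rel r X" "order_convex r X" and P: "order_convex r (X \<union> Y)" and disj: "X \<inter> Y = {}"
    using inv by (auto simp: B_inv_def cc_rel_def)
  have RA: "R \<subseteq> A" using R v by auto
  have "cc_rel r (X \<union> R)"
  proof (rule cc_rel_extend[OF assms(1) X(1) P])
    show "X \<union> R \<subseteq> X \<union> Y" "R \<subseteq> r `` X - X" using RA A by auto
    fix u z assume u: "z \<in> R" "(u, z) \<in> r" "u \<in> r `` X" "u \<in> X \<union> Y"
    then have "(u, v) \<in> r" using R \<open>trans r\<close> by (auto dest: transD)
    then show "u \<in> X \<union> R" using u A R by auto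
  qed
  moreover have "X \<union> R \<union> (Y - R) = X \<union> Y" using RA A by auto
  ultimately show "B_inv r (X \<union> R) (Y - R)" using P disj by (auto simp: B_inv_def)
  have "order_convex r (X \<union> Y - {v})"
    by (rule order_convex_remove[OF assms(1) X(2) P]) (use v A max in auto)
  moreover have "X \<union> Y - {v} = X \<union> (Y - {v})" using v A by auto
  ultimately show "B_inv r X (Y - {v})" using X disj by (auto simp: B_inv_def)
  fix Z assume "cc_rel r Z" "X \<subseteq> Z" "v \<in> Z"
  then show "R \<subseteq> Z" using R A order_convexD[of r Z _ v] by (auto simp: cc_rel_def)
qed

section \<open>Neighbourhoods as relational images, and the branches of the abstract
  subroutine\<close>

lemma out_nbrs_set_Image: "out_nbrs_set T X = parcs T `` X - X"
  by (auto simp: out_nbrs_set_def out_nbrs_def)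

lemma in_nbrs_set_Image: "in_nbrs_set T X = (parcs T)\<inverse> `` X - X"
  by (auto simp: in_nbrs_set_def in_nbrs_def)

lemma last_in_maximal:
  assumes "acyclic_ordering T vs" "A \<subseteq> set vs" "b \<in> A"
  shows "(last_in vs A, b) \<notin> parcs T"
proof
  let ?I = "{i. i < length vs \<and> vs ! i \<in> A}"
  assume arc: "(last_in vs A, b) \<in> parcs T"
  obtain j where j: "j < length vs" "vs ! j = b" using assms by (metis in_set_conv_nth subsetD)
  then have "j \<in> ?I" using assms by auto
  moreover have "finite ?I" by simp
  ultimately have "j \<le> Max ?I" "Max ?I \<in> ?I" using Max_in[of ?I] Max_ge[of ?I j] by blast+
  moreover have "Max ?I < j"
    using assms(1) arc j calculation(2) unfolding acyclic_ordering_def last_in_def by auto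
  ultimately show False by simp
qed

lemma first_in_minimal:
  assumes "acyclic_ordering T vs" "A \<subseteq> set vs" "b \<in> A"
  shows "(b, first_in vs A) \<notin> parcs T"
proof
  let ?I = "{i. i < length vs \<and> vs ! i \<in> A}"
  assume arc: "(b, first_in vs A) \<in> parcs T"
  obtain j where j: "j < length vs" "vs ! j = b" using assms by (metis in_set_conv_nth subsetD)
  then have "j \<in> ?I" using assms by auto
  moreover have "finite ?I" by simp
  ultimately have "Min ?I \<le> j" "Min ?I \<in> ?I" using Min_in[of ?I] Min_le[of ?I j] by blast+
  moreover have "j < Min ?I"
    using assms(1) arc j calculation(2) unfolding acyclic_ordering_def first_in_def by auto
  ultimately show False by simp
qed

lemma B_inv_out_step:
  assumes "trans (parcs T)" "acyclic_ordering T vs" "B_inv (parcs T) X Y" "Y \<subseteq> set vs"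
    and A: "A = out_nbrs_set T X \<inter> Y" "A \<noteq> {}"
    and v: "v = last_in vs A" and R: "R = {v} \<union> (in_nbrs T v \<inter> A)"
  shows "v \<in> A" "R \<subseteq> A" and "B_inv (parcs T) (X \<union> R) (Y - R)" and "B_inv (parcs T) X (Y - {v})"
    and "\<And>Z. cc_rel (parcs T) Z \<Longrightarrow> X \<subseteq> Z \<Longrightarrow> v \<in> Z \<Longrightarrow> R \<subseteq> Z"
proof -
  have A': "A = (parcs T `` X - X) \<inter> Y" using A by (simp add: out_nbrs_set_Image)
  have sub: "A \<subseteq> set vs" using A assms(4) by auto
  then show vA: "v \<in> A" using v last_in_mem[OF A(2)] by simp
  then show "R \<subseteq> A" using R by auto
  have R': "R = {v} \<union> ((parcs T)\<inverse> `` {v} \<inter> A)" using R by (auto simp: in_nbrs_def)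
  note step = B_inv_step[OF assms(1,3) A' vA _ R']
  show "B_inv (parcs T) (X \<union> R) (Y - R)" and "B_inv (parcs T) X (Y - {v})"
    and "\<And>Z. cc_rel (parcs T) Z \<Longrightarrow> X \<subseteq> Z \<Longrightarrow> v \<in> Z \<Longrightarrow> R \<subseteq> Z"
    using step last_in_maximal[OF assms(2) sub] v by blast+
qed

text \<open>The previous lemma for the converse order: the first vertex of the ordering within
  \<open>A\<close> is minimal for the arcs, hence maximal for their converse.\<close>

lemma B_inv_in_step:
  assumes "trans (parcs T)" "acyclic_ordering T vs" "B_inv (parcs T) X Y" "Y \<subseteq> set vs"
    and A: "A = in_nbrs_set T X \<inter> Y" "A \<noteq> {}"
    and v: "v = first_in vs A" and R: "R = {v} \<union> (out_nbrs T v \<inter> A)"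
  shows "v \<in> A" "R \<subseteq> A" and "B_inv (parcs T) (X \<union> R) (Y - R)" and "B_inv (parcs T) X (Y - {v})"
    and "\<And>Z. cc_rel (parcs T) Z \<Longrightarrow> X \<subseteq> Z \<Longrightarrow> v \<in> Z \<Longrightarrow> R \<subseteq> Z"
proof -
  let ?q = "(parcs T)\<inverse>"
  have A': "A = (?q `` X - X) \<inter> Y" using A by (simp add: in_nbrs_set_Image)
  have sub: "A \<subseteq> set vs" using A assms(4) by auto
  then show vA: "v \<in> A" using v first_in_mem[OF A(2)] by simp
  then show "R \<subseteq> A" using R by auto
  have R': "R = {v} \<union> (?q\<inverse> `` {v} \<inter> A)" using R by (auto simp: out_nbrs_def)
  have "trans ?q" "B_inv ?q X Y" using assms(1,3) by (simp_all add: B_inv_converse)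
  note step = B_inv_step[OF this A' vA _ R']
  show "B_inv (parcs T) (X \<union> R) (Y - R)" and "B_inv (parcs T) X (Y - {v})"
    and "\<And>Z. cc_rel (parcs T) Z \<Longrightarrow> X \<subseteq> Z \<Longrightarrow> v \<in> Z \<Longrightarrow> R \<subseteq> Z"
    using step first_in_minimal[OF assms(2) sub] v B_inv_converse cc_rel_converse by blast+
qed

lemma alg_B_out:
  assumes "Y \<subseteq> set vs" "A = out_nbrs_set T X \<inter> Y" "A \<noteq> {}"
    "v = last_in vs A" "R = {v} \<union> (in_nbrs T v \<inter> A)"
  shows "alg_B T vs X Y = alg_B T vs (X \<union> R) (Y - R) @ alg_B T vs X (Y - {v})"
  using assms by (subst alg_B.simps) (simp add: Let_def)

lemma alg_B_in:
  assumes "Y \<subseteq> set vs" "out_nbrs_set T X \<inter> Y = {}" "B = in_nbrs_set T X \<inter> Y" "B \<noteq> {}"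
    "v = first_in vs B" "R = {v} \<union> (out_nbrs T v \<inter> B)"
  shows "alg_B T vs X Y = alg_B T vs (X \<union> R) (Y - R) @ alg_B T vs X (Y - {v})"
  using assms by (subst alg_B.simps) (simp add: Let_def)

lemma alg_B_leaf:
  assumes "Y \<subseteq> set vs" "out_nbrs_set T X \<inter> Y = {}" "in_nbrs_set T X \<inter> Y = {}"
  shows "alg_B T vs X Y = [X]"
  using assms by (subst alg_B.simps) (simp add: Let_def)

text \<open>The two calls split the cc-sets between \<open>X\<close> and \<open>X \<union> Y\<close>
  by whether they contain \<open>v\<close>, and those that do contain all of \<open>R\<close>. The
  same split yields completeness and the absence of repetitions.\<close>

lemma alg_B_correct:
  assumes T: "trans (parcs T)" "acyclic_ordering T vs"
  shows "B_inv (parcs T) X Y \<Longrightarrow> Y \<subseteq> set vs \<Longrightarrow>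
    distinct (alg_B T vs X Y) \<and>
    set (alg_B T vs X Y) = {Z. cc_rel (parcs T) Z \<and> X \<subseteq> Z \<and> Z \<subseteq> X \<union> Y}"
proof (induction "card Y" arbitrary: X Y rule: less_induct)
  case less
  let ?out = "\<lambda>X Y. {Z. cc_rel (parcs T) Z \<and> X \<subseteq> Z \<and> Z \<subseteq> X \<union> Y}"
  let ?A = "out_nbrs_set T X \<inter> Y" and ?B = "in_nbrs_set T X \<inter> Y"
  have finY: "finite Y" using less.prems finite_subset by auto
  have branch: ?case
    if inv: "B_inv (parcs T) (X \<union> R) (Y - R)" "B_inv (parcs T) X (Y - {v})"
      and v: "v \<in> R" "R \<subseteq> Y" and R: "\<And>Z. cc_rel (parcs T) Z \<Longrightarrow> X \<subseteq> Z \<Longrightarrow> v \<in> Z \<Longrightarrow> R \<subseteq> Z"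
      and eq: "alg_B T vs X Y = alg_B T vs (X \<union> R) (Y - R) @ alg_B T vs X (Y - {v})" for R v
  proof -
    have "v \<in> Y" using v by auto
    have "card (Y - R) < card Y" "card (Y - {v}) < card Y"
      using v finY by (auto intro!: psubset_card_mono)
    then have IH: "distinct (alg_B T vs (X \<union> R) (Y - R))" "distinct (alg_B T vs X (Y - {v}))"
      "set (alg_B T vs (X \<union> R) (Y - R)) = ?out (X \<union> R) (Y - R)"
      "set (alg_B T vs X (Y - {v})) = ?out X (Y - {v})"
      using less.hyps[of "Y - R" "X \<union> R"] less.hyps[of "Y - {v}" X] inv less.prems(2) by blast+
    have "v \<notin> X" using less.prems(1) v by (auto simp: B_inv_def)
    have "?out (X \<union> R) (Y - R) \<inter> ?out X (Y - {v}) = {}" using v \<open>v \<notin> X\<close> by auto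
    moreover have "?out (X \<union> R) (Y - R) \<union> ?out X (Y - {v}) = ?out X Y"
    proof (intro equalityI subsetI)
      fix Z assume "Z \<in> ?out X Y"
      then show "Z \<in> ?out (X \<union> R) (Y - R) \<union> ?out X (Y - {v})" using R[of Z] by (cases "v \<in> Z") auto
    qed (use v in auto)
    ultimately show ?case unfolding eq distinct_append set_append IH(3,4) using IH(1,2) by blast
  qed
  consider "?A \<noteq> {}" | "?A = {}" "?B \<noteq> {}" | "?A = {}" "?B = {}" by blast
  then show ?case
  proof cases
    case 1
    note step = B_inv_out_step[OF T less.prems refl 1 refl refl]
    show ?thesis
      by (rule branch[OF step(3,4) _ _ step(5) alg_B_out[OF less.prems(2) refl 1 refl refl]])
        (use step(2) in auto)
  next
    case 2
    note step = B_inv_in_step[OF T less.prems refl 2(2) refl refl]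
    show ?thesis
      by (rule branch[OF step(3,4) _ _ step(5) alg_B_in[OF less.prems(2) 2(1) refl 2(2) refl refl]])
        (use step(2) in auto)
  next
    case 3
    have "Z = X" if Z: "cc_rel (parcs T) Z" "X \<subseteq> Z" "Z \<subseteq> X \<union> Y" for Z
    proof (rule ccontr)
      assume "Z \<noteq> X"
      then obtain y where "y \<in> Z - X" "y \<in> parcs T `` X \<union> (parcs T)\<inverse> `` X"
        using cc_rel_exit[of "parcs T" X Z] Z less.prems(1) by (auto simp: B_inv_def)
      then have "y \<in> ?A \<union> ?B" using Z(3) by (auto simp: out_nbrs_set_Image in_nbrs_set_Image)
      then show False using 3 by simp
    qed
    then show ?thesis using alg_B_leaf[OF less.prems(2) 3] less.prems(1)
      by (auto simp: B_inv_def)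
  qed
qed

text \<open>A final segment of an acyclic ordering is closed under out-neighbours, which makes it
  convex.\<close>

lemma B_inv_suffix:
  assumes T: "irrefl (parcs T)" "trans (parcs T)" "acyclic_ordering T vs"
    and V: "parcs T \<subseteq> pverts T \<times> pverts T" and i: "i < length vs"
  shows "B_inv (parcs T) {vs ! i} (set (drop (Suc i) vs))"
proof -
  have d: "distinct vs" using T(3) by (simp add: acyclic_ordering_def)
  have eq: "{vs ! i} \<union> set (drop (Suc i) vs) = set (drop i vs)"
    using i by (metis Cons_nth_drop_Suc insert_is_Un list.simps(15))
  have "distinct (drop i vs)" using d by simp
  then have "vs ! i \<notin> set (drop (Suc i) vs)" using i by (metis Cons_nth_drop_Suc distinct.simps(2))
  moreover have "order_convex (parcs T) (set (drop i vs))"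
    unfolding order_convex_def
  proof (intro ballI allI impI)
    fix x y z assume x: "x \<in> set (drop i vs)" and xy: "(x, y) \<in> parcs T"
    then have "y \<in> set vs" using V T(3) by (auto simp: acyclic_ordering_def)
    then obtain j where j: "j < length vs" "vs ! j = y" by (auto simp: in_set_conv_nth)
    obtain k where k: "k < length (drop i vs)" "drop i vs ! k = x"
      using x by (metis in_set_conv_nth)
    have "i + k < j" using T(3) xy j k unfolding acyclic_ordering_def by auto
    then have "y = drop i vs ! (j - i)" "j - i < length (drop i vs)" using j k by auto
    then show "y \<in> set (drop i vs)" by (metis nth_mem)
  qed
  ultimately show ?thesis using cc_rel_singleton[OF T(1,2)] unfolding B_inv_def eq by simp
qed

text \<open>Each cc-set is produced by the call for its first vertex in the ordering, and by no
  other: the call for \<open>i\<close> outputs only sets that contain \<open>vs ! i\<close> and no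
  earlier vertex.\<close>

lemma alg_A_correct_rel:
  assumes T: "T = TC D" "irrefl (parcs T)" "trans (parcs T)" "acyclic_ordering T vs"
    and V: "parcs T \<subseteq> pverts T \<times> pverts T"
  shows "distinct (alg_A D vs) \<and> set (alg_A D vs) = {X. X \<subseteq> pverts T \<and> cc_rel (parcs T) X}"
proof -
  let ?Y = "\<lambda>i. set (drop (Suc i) vs)"
  let ?o = "\<lambda>i. alg_B T vs {vs ! i} (?Y i)"
  let ?out = "\<lambda>i. {Z. cc_rel (parcs T) Z \<and> {vs ! i} \<subseteq> Z \<and> Z \<subseteq> {vs ! i} \<union> ?Y i}"
  have d: "distinct vs" "set vs = pverts T" using T(4) by (auto simp: acyclic_ordering_def)
  have o: "distinct (?o i)" "set (?o i) = ?out i" if "i < length vs" for i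
    using alg_B_correct[OF T(3,4) B_inv_suffix[OF T(2-4) V that]] set_drop_subset[of "Suc i" vs] by blast+
  have disj: "?out i \<inter> ?out j = {}" if "i < j" "j < length vs" for i j
  proof -
    have "vs ! i \<noteq> vs ! j" using that d by (auto simp: nth_eq_iff_index_eq)
    moreover have "vs ! i \<notin> ?Y j"
    proof
      assume "vs ! i \<in> ?Y j"
      then obtain k where "k < length vs - Suc j" "vs ! (Suc j + k) = vs ! i"
        by (auto simp: in_set_conv_nth)
      then show False using that d by (auto simp: nth_eq_iff_index_eq)
    qed
    ultimately show ?thesis by blast
  qed
  have distinct: "distinct (concat (map ?o [0..<m]))" if "m \<le> length vs" for m
    using that
  proof (induction m)
    case (Suc m)
    have "set (concat (map ?o [0..<m])) \<inter> set (?o m) = {}"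
    proof -
      have "set (?o i) \<inter> set (?o m) = {}" if "i < m" for i
        using disj[OF that] o(2)[of i] o(2)[of m] Suc.prems that by auto
      then show ?thesis unfolding set_concat set_map set_upt by fastforce
    qed
    then show ?case using Suc o(1)[of m] by simp
  qed simp
  have "set (concat (map ?o [0..<length vs])) = (\<Union>i<length vs. ?out i)"
    using o(2) by (simp add: lessThan_atLeast0)
  also have "\<dots> = {X. X \<subseteq> set vs \<and> cc_rel (parcs T) X}"
  proof (intro equalityI subsetI)
    fix X assume "X \<in> (\<Union>i<length vs. ?out i)"
    then show "X \<in> {X. X \<subseteq> set vs \<and> cc_rel (parcs T) X}"
      using set_drop_subset[of _ vs] by fastforce
  next
    fix X assume X: "X \<in> {X. X \<subseteq> set vs \<and> cc_rel (parcs T) X}"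
    then have "\<exists>i. i < length vs \<and> vs ! i \<in> X"
      by (auto simp: cc_rel_def link_connected_def) (metis ex_in_conv in_set_conv_nth subsetD)
    then obtain i where i: "i < length vs" "vs ! i \<in> X"
      and min: "\<And>j. j < i \<Longrightarrow> \<not> (j < length vs \<and> vs ! j \<in> X)"
      using exists_least_iff[of "\<lambda>i. i < length vs \<and> vs ! i \<in> X"] by blast
    have "X \<subseteq> {vs ! i} \<union> ?Y i"
    proof
      fix x assume x: "x \<in> X"
      then obtain j where j: "j < length vs" "vs ! j = x" using X by (auto simp: subset_iff in_set_conv_nth)
      then have "\<not> j < i" using min x by auto
      then show "x \<in> {vs ! i} \<union> ?Y i"
        using j by (cases "j = i") (auto simp: in_set_conv_nth intro!: exI[of _ "j - Suc i"])
    qed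
    then show "X \<in> (\<Union>i<length vs. ?out i)" using X i by auto
  qed
  finally show ?thesis using distinct[of "length vs"] T(1) d(2) unfolding alg_A_def by simp
qed

subsection \<open>Connected convex sets of an acyclic digraph\<close>

lemma parcs_TC: "parcs (TC D) = (parcs D)\<^sup>+"
  by (auto simp: TC_def)

lemma pverts_TC: "pverts (TC D) = pverts D"
  by (simp add: TC_def)

context
  fixes D :: "'a pair_pre_digraph"
  assumes D: "acyclic_digraph D"
begin

interpretation pair_digraph D
  using D by (simp add: acyclic_digraph_def)

lemma no_cycle: "\<not> cycle p"
  using D by (auto simp: acyclic_digraph_def)

text \<open>Convexity is defined by paths, whereas the transitive closure provides walks. In an
  acyclic digraph the two coincide, because a repeated vertex would yield a closed walk and thus a
  cycle.\<close>

lemma awalk_apath: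
  assumes "awalk u p v"
  shows "apath u p v"
proof (rule ccontr)
  assume "\<not> apath u p v"
  then have "\<not> distinct (pawalk_verts u p)" using assms by (auto simp: apath_def)
  then obtain q s t where "p = q @ s @ t" "distinct (pawalk_verts u q)" "\<exists>w. awalk u q w \<and> awalk w s w \<and> awalk w t v" "s \<noteq> []"
    using awalk_not_distinct_decomp[OF assms] by blast
  then have "closed_w s" by (auto simp: closed_w_def)
  then show False using closed_w_imp_cycle no_cycle by metis
qed

lemma trans_TC: "trans (parcs (TC D))"
  by (simp add: parcs_TC)

lemma irrefl_TC: "irrefl (parcs (TC D))"
proof -
  have "(x, x) \<notin> (parcs D)\<^sup>+" for x
  proof
    assume "(x, x) \<in> (parcs D)\<^sup>+"
    then obtain p where "awalk x p x" "p \<noteq> []" using reachable1_awalk by auto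
    then have "closed_w p" by (auto simp: closed_w_def)
    then show False using closed_w_imp_cycle no_cycle by metis
  qed
  then show ?thesis by (simp add: parcs_TC irrefl_def)
qed

lemma TC_wf: "parcs (TC D) \<subseteq> pverts (TC D) \<times> pverts (TC D)"
  unfolding parcs_TC pverts_TC using wellformed'
  by (intro trancl_subset_Sigma) auto

text \<open>Two arcs of the closure meeting at \<open>y\<close> give two walks whose concatenation
  is a path through \<open>y\<close>. Conversely, a vertex on a path from \<open>u\<close> to
  \<open>v\<close> is one of the ends or lies strictly between them in the closure.\<close>

lemma convex_set_iff:
  assumes "X \<subseteq> pverts D"
  shows "convex_set D X \<longleftrightarrow> X \<noteq> {} \<and> order_convex (parcs (TC D)) X"
proof -
  have "order_convex (parcs (TC D)) X" if c: "convex_set D X"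
    unfolding order_convex_def parcs_TC
  proof (intro ballI allI impI)
    fix x y z assume x: "x \<in> X" "z \<in> X" "(x, y) \<in> (parcs D)\<^sup>+" "(y, z) \<in> (parcs D)\<^sup>+"
    then obtain p q where pq: "awalk x p y" "awalk y q z" using reachable1_awalk by metis
    then have w: "awalk x (p @ q) z" by simp
    then have "apath x (p @ q) z" by (rule awalk_apath)
    then have "set (pawalk_verts x (p @ q)) \<subseteq> X" using c x unfolding convex_set_def by auto
    moreover have "y \<in> set (pawalk_verts x (p @ q))"
      using pq w hd_in_awalk_verts(1)[OF pq(2)] by (auto simp: set_awalk_verts_append)
    ultimately show "y \<in> X" by auto
  qed
  moreover have "set (pawalk_verts u p) \<subseteq> X"
    if c: "order_convex (parcs (TC D)) X" and u: "u \<in> X" "v \<in> X" "apath u p v" for u p v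
  proof
    fix y assume y: "y \<in> set (pawalk_verts u p)"
    have "awalk u p v" using u by (simp add: apath_def)
    then have "u \<rightarrow>\<^sup>*\<^bsub>D\<^esub> y" "y \<rightarrow>\<^sup>*\<^bsub>D\<^esub> v"
      using y awalk_verts_reachable_from awalk_verts_reachable_to by auto
    then show "y \<in> X"
      using c u reachable_neq_reachable1[of u y] reachable_neq_reachable1[of y v]
        order_convexD[OF c u(1,2), of y] by (auto simp: parcs_TC)
  qed
  ultimately show ?thesis unfolding convex_set_def by auto
qed

text \<open>Reachability in the library is reflexive only on the vertex set, that of
  \<open>link_connected\<close> is reflexive everywhere; they agree on \<open>X\<close>.\<close>

lemma connected_iff_link:
  "Digraph_Component.connected (with_proj D \<restriction> X) \<longleftrightarrow> link_connected (parcs D) X"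
proof -
  have "arcs_ends (with_proj D \<restriction> X) = parcs D \<inter> X \<times> X"
    by (auto simp: arcs_ends_def arc_to_ends_def)
  then have s: "(arcs_ends (with_proj D \<restriction> X))\<^sup>s = link (parcs D) X"
    by (auto simp: link_def symcl_def)
  have "(u, v) \<in> rtrancl_on X (link (parcs D) X) \<longleftrightarrow> (u, v) \<in> (link (parcs D) X)\<^sup>*"
    if "u \<in> X" "v \<in> X" for u v
    using that rtrancl_on_rtranclI rtrancl_consistent_rtrancl_on[of u v "link (parcs D) X" X]
    by (auto simp: link_def)
  then show ?thesis unfolding connected_conv s
    by (auto simp: link_connected_def)
qed

text \<open>Convexity is what makes this true: an arc of the closure inside \<open>X\<close> comes
  from a path of \<open>D\<close>, all of whose vertices then lie in \<open>X\<close>, so it can be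
  replaced by a walk in the subgraph induced by \<open>X\<close>.\<close>

lemma link_connected_TC:
  assumes c: "order_convex (parcs (TC D)) X"
  shows "link_connected (parcs (TC D)) X \<longleftrightarrow> link_connected (parcs D) X"
proof -
  have arc: "(a, b) \<in> (link (parcs D) X)\<^sup>*" if "(a, b) \<in> (parcs D)\<^sup>+" "a \<in> X" "b \<in> X" for a b
    using that
  proof (induction rule: converse_trancl_induct)
    case (base a)
    then show ?case by (auto simp: link_def)
  next
    case (step a y)
    then have "y \<in> X" using order_convexD[OF c, of a b y] by (auto simp: parcs_TC)
    then have "(a, y) \<in> link (parcs D) X" "(y, b) \<in> (link (parcs D) X)\<^sup>*"
      using step by (auto simp: link_def)
    then show ?case by (rule converse_rtrancl_into_rtrancl)
  qed
  have "link (parcs (TC D)) X \<subseteq> (link (parcs D) X)\<^sup>*"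
    using arc sym_rtrancl[OF sym_link[of "parcs D" X]]
    by (auto simp: link_def[of "(parcs D)\<^sup>+"] parcs_TC dest: symD)
  then have "(link (parcs (TC D)) X)\<^sup>* \<subseteq> (link (parcs D) X)\<^sup>*" by (rule rtrancl_subset_rtrancl)
  moreover have "link (parcs D) X \<subseteq> link (parcs (TC D)) X"
    by (auto simp: link_def parcs_TC)
  then have "(link (parcs D) X)\<^sup>* \<subseteq> (link (parcs (TC D)) X)\<^sup>*" by (rule rtrancl_mono)
  ultimately have "(link (parcs D) X)\<^sup>* = (link (parcs (TC D)) X)\<^sup>*" by blast
  then show ?thesis by (simp add: link_connected_def)
qed

lemma cc_sets_eq: "cc_sets D = {X. X \<subseteq> pverts D \<and> cc_rel (parcs (TC D)) X}"
proof -
  have "connected_set D X \<and> convex_set D X \<longleftrightarrow> cc_rel (parcs (TC D)) X" if "X \<subseteq> pverts D" for X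
    using convex_set_iff[OF that] link_connected_TC[of X]
    unfolding connected_set_def connected_iff_link cc_rel_def
    by (auto simp: link_connected_def[of "parcs (TC D)"])
  then show ?thesis unfolding cc_sets_def by blast
qed

lemma cc_rel_pverts:
  assumes "Digraph_Component.connected (with_proj D)"
  shows "cc_rel (parcs (TC D)) (pverts D)"
proof -
  have "order_convex (parcs (TC D)) (pverts D)"
    using TC_wf unfolding order_convex_def pverts_TC by auto
  moreover have "with_proj D \<restriction> pverts D = with_proj D"
    using wellformed' by (auto simp: induce_subgraph_def with_proj_def)
  ultimately show ?thesis
    using assms connected_iff_link[of "pverts D"] link_connected_TC by (simp add: cc_rel_def)
qed

lemma cc_ge:
  assumes "Digraph_Component.connected (with_proj D)"
  shows "(card (pverts D))\<^sup>2 \<le> 2 * cc D"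
  using card_cc_rel_ge[OF irrefl_TC trans_TC _ cc_rel_pverts[OF assms]]
  by (simp add: cc_def cc_sets_eq power2_eq_square)

theorem alg_A_correct:
  assumes "acyclic_ordering (TC D) vs"
  shows "distinct (alg_A D vs)" "set (alg_A D vs) = cc_sets D"
  using alg_A_correct_rel[OF refl irrefl_TC trans_TC assms TC_wf]
  by (simp_all add: cc_sets_eq pverts_TC)

end

section \<open>Weakest preconditions\<close>

definition grid :: "nat \<Rightarrow> 'r cell set" where
  "grid w = UNIV \<times> {0..w} \<times> {0..w}"

text \<open>Existence of an execution includes termination. The accessed cells are confined to
  \<open>grid w\<close> here instead of being passed to \<open>Q\<close>: the space bound needs only
  a set that covers them, and index bounds can be checked access by access.\<close>

definition wp :: "nat \<Rightarrow> 'r com \<Rightarrow> 'r com \<Rightarrow> 'r store \<Rightarrow>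
    ('r store \<Rightarrow> nat option list \<Rightarrow> nat \<Rightarrow> nat \<Rightarrow> bool) \<Rightarrow> bool" where
  "wp w body c s Q \<longleftrightarrow>
    (\<exists>s' out t U d. exec w body c s s' out t U d \<and> U \<subseteq> grid w \<and> Q s' out t d)"

lemma grid_simps [simp]:
  "(a, i, j) \<in> grid w \<longleftrightarrow> i \<le> w \<and> j \<le> w"
  by (auto simp: grid_def)

lemma wp_mono:
  assumes "wp w body c s P" "\<And>s' out t d. P s' out t d \<Longrightarrow> Q s' out t d"
  shows "wp w body c s Q"
  using assms unfolding wp_def by blast

inductive_cases exec_AssignE: "exec w body (a\<langle>i,j\<rangle> ::= e) s s' out t U d"
inductive_cases exec_SeqE: "exec w body (c1;; c2) s s' out t U d"
inductive_cases exec_IfE: "exec w body (IF b THEN c1 ELSE c2) s s' out t U d"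
inductive_cases exec_SkipE: "exec w body Skip s s' out t U d"
inductive_cases exec_CallE: "exec w body Call s s' out t U d"
inductive_cases exec_PrintE: "exec w body (Print e) s s' out t U d"
inductive_cases exec_NewlineE: "exec w body Newline s s' out t U d"

lemma wp_Assign:
  "wp w body (a\<langle>i,j\<rangle> ::= e) s Q \<longleftrightarrow>
    eval e s \<le> w \<and> eval i s \<le> w \<and> eval j s \<le> w \<and>
    cells_read i s \<subseteq> grid w \<and> cells_read j s \<subseteq> grid w \<and> cells_read e s \<subseteq> grid w \<and>
    Q (s((a, eval i s, eval j s) := eval e s)) [] (1 + ops i + ops j + ops e) 0"
  (is "?l \<longleftrightarrow> ?r")
proof
  assume ?l then show ?r unfolding wp_def by (auto elim!: exec_AssignE)
next
  assume r: ?r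
  then have "insert (a, eval i s, eval j s) (cells_read i s \<union> cells_read j s \<union> cells_read e s) \<subseteq> grid w"
    by simp
  then show ?l using r exec.Assign[of e s w body a i j] unfolding wp_def by blast
qed

lemma wp_Seq:
  "wp w body (c1;; c2) s Q \<longleftrightarrow>
    wp w body c1 s (\<lambda>s1 out1 t1 d1. wp w body c2 s1
      (\<lambda>s2 out2 t2 d2. Q s2 (out1 @ out2) (t1 + t2) (max d1 d2)))"
  (is "?l \<longleftrightarrow> ?r")
proof
  assume ?l then show ?r unfolding wp_def by (elim exE conjE exec_SeqE) blast
next
  assume ?r then show ?l unfolding wp_def by (elim exE conjE) (blast intro: exec.Seq)
qed

lemma wp_If:
  "wp w body (IF b THEN c1 ELSE c2) s Q \<longleftrightarrow> cells_read b s \<subseteq> grid w \<and>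
    (if eval b s \<noteq> 0 then wp w body c1 s (\<lambda>s' out t d. Q s' out (1 + ops b + t) d)
     else wp w body c2 s (\<lambda>s' out t d. Q s' out (1 + ops b + t) d))"
  (is "?l \<longleftrightarrow> ?r")
proof
  assume ?l then show ?r unfolding wp_def by (elim exE conjE exec_IfE; simp; blast)
next
  assume r: ?r
  show ?l
  proof (cases "eval b s = 0")
    case True
    with r obtain s' out t U d where "exec w body c2 s s' out t U d" "U \<subseteq> grid w"
      "Q s' out (1 + ops b + t) d" "cells_read b s \<subseteq> grid w" by (auto simp: wp_def)
    then show ?thesis using exec.IfFalse[OF True] unfolding wp_def by (meson Un_least)
  next
    case False
    with r obtain s' out t U d where "exec w body c1 s s' out t U d" "U \<subseteq> grid w"
      "Q s' out (1 + ops b + t) d" "cells_read b s \<subseteq> grid w" by (auto simp: wp_def)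
    then show ?thesis using exec.IfTrue[OF False] unfolding wp_def by (meson Un_least)
  qed
qed

lemma wp_Skip: "wp w body Skip s Q \<longleftrightarrow> Q s [] 1 0"
  unfolding wp_def by (auto elim!: exec_SkipE intro!: exI exec.Skip)

lemma wp_Newline: "wp w body Newline s Q \<longleftrightarrow> Q s [None] 1 0"
  unfolding wp_def by (auto elim!: exec_NewlineE intro!: exI exec.Newline)

lemma wp_Print:
  "wp w body (Print e) s Q \<longleftrightarrow> cells_read e s \<subseteq> grid w \<and> Q s [Some (eval e s)] (1 + ops e) 0"
  unfolding wp_def by (auto elim!: exec_PrintE intro!: exI exec.Print)

lemma wp_Call:
  "wp w body Call s Q \<longleftrightarrow> wp w body body s (\<lambda>s' out t d. Q s' out (1 + t) (Suc d))"
  (is "?l \<longleftrightarrow> ?r")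
proof
  assume ?l then show ?r unfolding wp_def by (elim exE conjE exec_CallE) (simp, blast)
next
  assume ?r then show ?l unfolding wp_def by (elim exE conjE) (blast intro: exec.Call)
qed

lemma wp_WhileFalse:
  assumes "eval b s = 0" "cells_read b s \<subseteq> grid w" "Q s [] (1 + ops b) 0"
  shows "wp w body (WHILE b DO c) s Q"
  using assms exec.WhileFalse[OF assms(1)] unfolding wp_def by blast

lemma wp_WhileTrue:
  assumes b: "eval b s \<noteq> 0" "cells_read b s \<subseteq> grid w"
    and c: "wp w body c s (\<lambda>s1 out1 t1 d1. wp w body (WHILE b DO c) s1
      (\<lambda>s2 out2 t2 d2. Q s2 (out1 @ out2) (1 + ops b + t1 + t2) (max d1 d2)))"
  shows "wp w body (WHILE b DO c) s Q"
proof -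
  obtain s1 out1 t1 U1 d1 s2 out2 t2 U2 d2 where
    "exec w body c s s1 out1 t1 U1 d1" "exec w body (WHILE b DO c) s1 s2 out2 t2 U2 d2"
    "U1 \<subseteq> grid w" "U2 \<subseteq> grid w" "Q s2 (out1 @ out2) (1 + ops b + t1 + t2) (max d1 d2)"
    using c unfolding wp_def by blast
  then show ?thesis using exec.WhileTrue[OF b(1)] b(2) unfolding wp_def by (meson Un_least)
qed

text \<open>These are equivalences, so loop-free code is executed by rewriting.
  \<open>wp_Call\<close> stays out, since unfolding a call would unroll the recursion instead of
  leaving it to an induction hypothesis.\<close>

lemmas wp_simps = wp_Assign wp_Seq wp_If wp_Skip wp_Newline wp_Print

text \<open>The invariant also sees the output, time and call depth accumulated so far; one round of the
  loop control costs 15 operations.\<close>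

lemma wp_For:
  fixes i :: reg
  assumes i: "i \<noteq> Num" and num: "s (Num, 0, 0) = w"
    and init: "Inv 0 (s((i, 0, 0) := 0)) [] 4 0"
    and step: "\<And>k s out t d. k < w \<Longrightarrow> Inv k s out t d \<Longrightarrow> s (i, 0, 0) = k \<Longrightarrow> s (Num, 0, 0) = w \<Longrightarrow>
      wp w body c s (\<lambda>s' out' t' d'. s' (i, 0, 0) = k \<and> s' (Num, 0, 0) = w \<and>
        Inv (Suc k) (s'((i, 0, 0) := Suc k)) (out @ out') (t + t' + 15) (max d d'))"
    and final: "\<And>s out t d. Inv w s out t d \<Longrightarrow> s (i, 0, 0) = w \<Longrightarrow> s (Num, 0, 0) = w \<Longrightarrow>
      Q s out (t + 8) d"
  shows "wp w body (FOR i BELOW \<section>Num DO c) s Q"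
proof -
  let ?b = "Less (\<section>i) (\<section>Num)"
  \<comment> \<open>The total time is written as \<open>u + 8\<close>: \<open>u\<close> is what the
    invariant has counted, and 8 is the cost of the final failing test.\<close>
  have loop: "wp w body (WHILE ?b DO (c;; \<section>i ::= Succ (\<section>i))) s
      (\<lambda>s' out' t' d'. \<exists>u. Inv w s' (out @ out') u (max d d') \<and> t + t' = u + 8 \<and>
         s' (i, 0, 0) = w \<and> s' (Num, 0, 0) = w)"
    if "k \<le> w" "Inv k s out t d" "s (i, 0, 0) = k" "s (Num, 0, 0) = w" for k s out t d
    using that
  proof (induction "w - k" arbitrary: k s out t d)
    case 0
    then show ?case by (intro wp_WhileFalse) auto
  next
    case (Suc m)
    show ?case
    proof (rule wp_WhileTrue)
      show "wp w body (c;; \<section>i ::= Succ (\<section>i)) s (\<lambda>s1 out1 t1 d1.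
        wp w body (WHILE ?b DO (c;; \<section>i ::= Succ (\<section>i))) s1 (\<lambda>s2 out2 t2 d2.
          \<exists>u. Inv w s2 (out @ out1 @ out2) u (max d (max d1 d2)) \<and>
            t + (1 + ops ?b + t1 + t2) = u + 8 \<and> s2 (i, 0, 0) = w \<and> s2 (Num, 0, 0) = w))"
        unfolding wp_Seq
      proof (rule wp_mono[OF step[of k s out t d]], goal_cases)
        case (5 s' out' t' d')
        have "wp w body (WHILE ?b DO (c;; \<section>i ::= Succ (\<section>i))) (s'((i, 0, 0) := Suc k))
            (\<lambda>s2 out2 t2 d2. \<exists>u. Inv w s2 ((out @ out') @ out2) u (max (max d d') d2) \<and>
              t + t' + 15 + t2 = u + 8 \<and> s2 (i, 0, 0) = w \<and> s2 (Num, 0, 0) = w)"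
          using 5 Suc.prems Suc.hyps(2) i by (intro Suc.hyps(1)[of "Suc k"]) auto
        then have "wp w body (WHILE ?b DO (c;; \<section>i ::= Succ (\<section>i))) (s'((i, 0, 0) := Suc k))
            (\<lambda>s2 out2 t2 d2. \<exists>u. Inv w s2 (out @ (out' @ []) @ out2) u (max d (max (max d' 0) d2)) \<and>
              t + (1 + ops ?b + (t' + (1 + ops (Const 0) + ops (Const 0) + ops (Succ \<section>i))) + t2) = u + 8 \<and>
              s2 (i, 0, 0) = w \<and> s2 (Num, 0, 0) = w)"
          by (rule wp_mono) (auto simp: max.assoc)
        then show ?case unfolding wp_Assign using 5 Suc.hyps(2) by simp
      qed (use Suc in auto)
    qed (use Suc in auto)
  qed
  have "wp w body (WHILE ?b DO (c;; \<section>i ::= Succ (\<section>i))) (s((i, 0, 0) := 0))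
      (\<lambda>s' out' t' d'. \<exists>u. Inv w s' ([] @ out') u (max 0 d') \<and> 4 + t' = u + 8 \<and>
         s' (i, 0, 0) = w \<and> s' (Num, 0, 0) = w)"
    using i num init by (intro loop[of 0]) auto
  then have "wp w body (WHILE ?b DO (c;; \<section>i ::= Succ (\<section>i))) (s((i, 0, 0) := 0))
      (\<lambda>s' out' t' d'. Q s' out' (4 + t') d')"
    by (rule wp_mono) (elim exE conjE, erule ssubst, rule final, simp_all)
  then show ?thesis by (simp add: For_def wp_Seq wp_Assign eval_nat_numeral)
qed

text \<open>For loops without calls whose rounds have a uniform cost bound, which is every loop
  except the outermost one of \<open>step3\<close>; time need not appear in the invariant. The 12
  consists of 4 for the initial assignment and 8 for the last test.\<close>

lemma wp_For_const:
  fixes i :: reg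
  assumes i: "i \<noteq> Num" and num: "s (Num, 0, 0) = w"
    and init: "Inv 0 (s((i, 0, 0) := 0)) []"
    and step: "\<And>k s out. k < w \<Longrightarrow> Inv k s out \<Longrightarrow> s (i, 0, 0) = k \<Longrightarrow> s (Num, 0, 0) = w \<Longrightarrow>
      wp w body c s (\<lambda>s' out' t d. s' (i, 0, 0) = k \<and> s' (Num, 0, 0) = w \<and>
        Inv (Suc k) (s'((i, 0, 0) := Suc k)) (out @ out') \<and> t \<le> T \<and> d = 0)"
    and final: "\<And>s out t. Inv w s out \<Longrightarrow> s (i, 0, 0) = w \<Longrightarrow> s (Num, 0, 0) = w \<Longrightarrow>
      t \<le> 12 + w * (T + 15) \<Longrightarrow> Q s out t 0"
  shows "wp w body (FOR i BELOW \<section>Num DO c) s Q"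
proof (rule wp_For[where Inv = "\<lambda>k s out t d. Inv k s out \<and> t \<le> 4 + k * (T + 15) \<and> d = 0"], goal_cases)
  case (4 k s out t d)
  show ?case
    by (rule wp_mono[OF step[of k s out]]) (use 4 in auto)
next
  case (5 s out t d)
  then show ?case using final[of s out "t + 8"] by auto
qed (use assms in auto)

section \<open>The subroutine\<close>

text \<open>A call at level \<open>L\<close> changes only \<open>I\<close> and the rows from \<open>L\<close> on.\<close>

definition keep :: "nat \<Rightarrow> reg store \<Rightarrow> reg store \<Rightarrow> bool" where
  "keep L s s' \<longleftrightarrow> (\<forall>a i j. a \<noteq> I \<longrightarrow> (a \<in> {ArrX, ArrY, ArrA, ArrB, ArrV} \<longrightarrow> i < L) \<longrightarrow>
     s' (a, i, j) = s (a, i, j))"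

lemma keepD:
  "keep L s s' \<Longrightarrow> a \<noteq> I \<Longrightarrow> (a \<in> {ArrX, ArrY, ArrA, ArrB, ArrV} \<Longrightarrow> i < L) \<Longrightarrow>
    s' (a, i, j) = s (a, i, j)"
  unfolding keep_def by blast

lemma keep_refl [simp]: "keep L s s"
  by (simp add: keep_def)

lemma keep_trans: "keep L s s1 \<Longrightarrow> keep M s1 s2 \<Longrightarrow> L \<le> M \<Longrightarrow> keep L s s2"
  unfolding keep_def by (auto dest: less_le_trans)

lemma keep_upd:
  "keep L s s' \<Longrightarrow> a = I \<or> a \<in> {ArrX, ArrY, ArrA, ArrB, ArrV} \<and> L \<le> i \<Longrightarrow>
    keep L s (s'((a, i, j) := x))"
  unfolding keep_def by auto

text \<open>Shared by the out- and the in-neighbour branch. The predicates \<open>pR\<close>,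
  \<open>pA\<close>, \<open>pB\<close> are the meanings of the three expressions; \<open>ev\<close>
  asks for them in every store that agrees with \<open>s\<close> up to \<open>I\<close> and the rows
  above \<open>L\<close>, since the loop writes only there.\<close>

lemma wp_branch:
  fixes pR pA pB :: "nat \<Rightarrow> bool"
  assumes s: "s (Num, 0, 0) = n" "s (Lev, 0, 0) = L" "L < n" "s (ArrV, L, 0) = v" "v < n"
    and ev: "\<And>e p s'. (e, p) \<in> {(inR, pR), (newA, pA), (newB, pB)} \<Longrightarrow> keep (Suc L) s s' \<Longrightarrow>
      s' (I, 0, 0) < n \<Longrightarrow>
      (eval (e (\<section>I)) s' = 0 \<longleftrightarrow> \<not> p (s' (I, 0, 0))) \<and> cells_read (e (\<section>I)) s' \<subseteq> grid n"
    and ops: "ops (inR (\<section>I)) \<le> 40" "ops (newA (\<section>I)) \<le> 40" "ops (newB (\<section>I)) \<le> 40"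
    and call1: "\<And>s1. keep (Suc L) (s((Lev, 0, 0) := Suc L)) s1 \<Longrightarrow>
      (\<And>i. i < n \<Longrightarrow>
        (s1 (ArrX, Suc L, i) \<noteq> 0 \<longleftrightarrow> s (ArrX, L, i) \<noteq> 0 \<or> pR i) \<and>
        (s1 (ArrY, Suc L, i) \<noteq> 0 \<longleftrightarrow> s (ArrY, L, i) \<noteq> 0 \<and> \<not> pR i) \<and>
        (s1 (ArrA, Suc L, i) \<noteq> 0 \<longleftrightarrow> s (ArrY, L, i) \<noteq> 0 \<and> \<not> pR i \<and> pA i) \<and>
        (s1 (ArrB, Suc L, i) \<noteq> 0 \<longleftrightarrow> s (ArrY, L, i) \<noteq> 0 \<and> \<not> pR i \<and> pB i)) \<Longrightarrow>
      wp n subroutine_B Call s1 (\<lambda>s2 out t d. out = out1 \<and> t \<le> t1 \<and> d \<le> d1 \<and> keep (Suc L) s1 s2)"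
    and call2: "\<And>s1. keep (Suc L) (s((ArrY, L, v) := 0, (ArrA, L, v) := 0, (ArrB, L, v) := 0)) s1 \<Longrightarrow>
      wp n subroutine_B Call s1 (\<lambda>s2 out t d. out = out2 \<and> t \<le> t2 \<and> d \<le> d2 \<and> keep L s1 s2)"
  shows "wp n subroutine_B (branch inR newA newB) s
    (\<lambda>s' out t d. out = out1 @ out2 \<and> t \<le> t1 + t2 + 1000 * n \<and> d \<le> max d1 d2 \<and> keep L s s')"
proof -
  have evR: "eval (inR (\<section>I)) s' = 0 \<longleftrightarrow> \<not> pR (s' (I, 0, 0))" "cells_read (inR (\<section>I)) s' \<subseteq> grid n"
    and evA: "eval (newA (\<section>I)) s' = 0 \<longleftrightarrow> \<not> pA (s' (I, 0, 0))" "cells_read (newA (\<section>I)) s' \<subseteq> grid n"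
    and evB: "eval (newB (\<section>I)) s' = 0 \<longleftrightarrow> \<not> pB (s' (I, 0, 0))" "cells_read (newB (\<section>I)) s' \<subseteq> grid n"
    if "keep (Suc L) s s'" "s' (I, 0, 0) < n" for s'
    using ev[OF _ that, of inR pR] ev[OF _ that, of newA pA] ev[OF _ that, of newB pB] by simp_all
  have n: "1 \<le> n" using s by simp
  define F where "F s1 i \<longleftrightarrow>
        (s1 (ArrX, Suc L, i) \<noteq> 0 \<longleftrightarrow> s (ArrX, L, i) \<noteq> 0 \<or> pR i) \<and>
        (s1 (ArrY, Suc L, i) \<noteq> 0 \<longleftrightarrow> s (ArrY, L, i) \<noteq> 0 \<and> \<not> pR i) \<and>
        (s1 (ArrA, Suc L, i) \<noteq> 0 \<longleftrightarrow> s (ArrY, L, i) \<noteq> 0 \<and> \<not> pR i \<and> pA i) \<and>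
        (s1 (ArrB, Suc L, i) \<noteq> 0 \<longleftrightarrow> s (ArrY, L, i) \<noteq> 0 \<and> \<not> pR i \<and> pB i)" for s1 :: "reg store" and i
  let ?loop = "FOR I BELOW \<section>Num DO
      (ArrX\<langle>Succ (\<section>Lev), \<section>I\<rangle> ::= Or (ArrX\<langle>\<section>Lev, \<section>I\<rangle>) (inR (\<section>I));;
       ArrY\<langle>Succ (\<section>Lev), \<section>I\<rangle> ::= And (ArrY\<langle>\<section>Lev, \<section>I\<rangle>) (Neg (inR (\<section>I)));;
       ArrA\<langle>Succ (\<section>Lev), \<section>I\<rangle> ::= And (ArrY\<langle>Succ (\<section>Lev), \<section>I\<rangle>) (newA (\<section>I));;
       ArrB\<langle>Succ (\<section>Lev), \<section>I\<rangle> ::= And (ArrY\<langle>Succ (\<section>Lev), \<section>I\<rangle>) (newB (\<section>I)))"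
  have loop: "wp n subroutine_B ?loop s (\<lambda>s1 out t d. out = [] \<and> keep (Suc L) s s1 \<and>
      (\<forall>i<n. F s1 i) \<and> t \<le> 12 + n * 415 \<and> d = 0)"
  proof (rule wp_For_const[where T = 400 and
        Inv = "\<lambda>k s1 out. out = [] \<and> keep (Suc L) s s1 \<and> (\<forall>i<k. F s1 i)"], goal_cases)
    case (4 k s1 out)
    then have k: "keep (Suc L) s s1" "s1 (I, 0, 0) = k" "k < n" and F: "\<forall>i<k. F s1 i" and [simp]: "out = []"
      by auto
    have Lev: "s1 (Lev, 0, 0) = L" "s1 (Num, 0, 0) = n"
      "s1 (ArrX, L, k) = s (ArrX, L, k)" "s1 (ArrY, L, k) = s (ArrY, L, k)"
      using s keepD[OF k(1)] by auto
    define x1 :: nat where "x1 = of_bool (s (ArrX, L, k) \<noteq> 0 \<or> pR k)"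
    define x2 :: nat where "x2 = of_bool (s (ArrY, L, k) \<noteq> 0 \<and> \<not> pR k)"
    define x3 :: nat where "x3 = of_bool (s (ArrY, L, k) \<noteq> 0 \<and> \<not> pR k \<and> pA k)"
    define x4 :: nat where "x4 = of_bool (s (ArrY, L, k) \<noteq> 0 \<and> \<not> pR k \<and> pB k)"
    have le: "of_bool b \<le> n" for b using n by (cases b) auto
    \<comment> \<open>The expressions are abstract, so their values are known only in stores related
      to \<open>s\<close> by \<open>keep\<close>. Hence each intermediate store gets a name and a
      \<open>keep\<close> fact of its own.\<close>
    define r1 where "r1 = s1((ArrX, Suc L, k) := x1)"
    define r2 where "r2 = r1((ArrY, Suc L, k) := x2)"
    define r3 where "r3 = r2((ArrA, Suc L, k) := x3)"
    define r4 where "r4 = r3((ArrB, Suc L, k) := x4)"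
    have keeps: "keep (Suc L) s r1" "keep (Suc L) s r2" "keep (Suc L) s r3" "keep (Suc L) s r4"
      using k(1) unfolding r1_def r2_def r3_def r4_def by (simp_all add: keep_upd)
    have I: "r1 (I, 0, 0) = k" "r2 (I, 0, 0) = k" "r3 (I, 0, 0) = k"
      "r1 (Lev, 0, 0) = L" "r2 (Lev, 0, 0) = L" "r3 (Lev, 0, 0) = L"
      "r1 (ArrY, L, k) = s (ArrY, L, k)" "r2 (ArrY, Suc L, k) = x2" "r3 (ArrY, Suc L, k) = x2"
      using k Lev unfolding r1_def r2_def r3_def by simp_all
    have "F r4 i" if "i < Suc k" for i
      using F that unfolding r1_def r2_def r3_def r4_def F_def x1_def x2_def x3_def x4_def
      by (cases "i = k") auto
    moreover have "F (r4((I, 0, 0) := Suc k)) i \<longleftrightarrow> F r4 i" for i unfolding F_def by simp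
    ultimately have fin: "r4 (I, 0, 0) = k" "r4 (Num, 0, 0) = n" "keep (Suc L) s (r4((I, 0, 0) := Suc k))"
        "\<forall>i<Suc k. F (r4((I, 0, 0) := Suc k)) i"
      using keeps(4) I(3) Lev(2) unfolding r4_def r3_def r2_def r1_def by (auto simp: keep_upd)
    have "eval (Or (ArrX\<langle>\<section>Lev, \<section>I\<rangle>) (inR (\<section>I))) s1 = x1"
      using evR[OF k(1)] k Lev by (simp add: x1_def)
    moreover have "eval (And (ArrY\<langle>\<section>Lev, \<section>I\<rangle>) (Neg (inR (\<section>I)))) r1 = x2"
      using evR[OF keeps(1)] k I by (simp add: x2_def)
    moreover have "eval (And (ArrY\<langle>Succ (\<section>Lev), \<section>I\<rangle>) (newA (\<section>I))) r2 = x3"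
      using evA[OF keeps(2)] k I by (simp add: x3_def x2_def)
    moreover have "eval (And (ArrY\<langle>Succ (\<section>Lev), \<section>I\<rangle>) (newB (\<section>I))) r3 = x4"
      using evB[OF keeps(3)] k I by (simp add: x4_def x2_def)
    moreover have "x1 \<le> n" "x2 \<le> n" "x3 \<le> n" "x4 \<le> n" unfolding x1_def x2_def x3_def x4_def by (rule le)+
    moreover have "cells_read (inR (\<section>I)) s1 \<subseteq> grid n" "cells_read (inR (\<section>I)) r1 \<subseteq> grid n"
      "cells_read (newA (\<section>I)) r2 \<subseteq> grid n" "cells_read (newB (\<section>I)) r3 \<subseteq> grid n"
      using evR(2) evA(2) evB(2) k keeps I by simp_all
    ultimately show ?case
      using ops s(3) fin
      by (simp add: wp_Seq wp_Assign k(2,3) Lev I less_imp_le flip: r1_def r2_def r3_def r4_def del: eval.simps(5-9) fun_upd_apply)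
  qed (use s in \<open>auto simp: keep_upd\<close>)
  show ?thesis
    unfolding branch_def wp_Seq
  proof (rule wp_mono[OF loop], goal_cases)
    case (1 s1 o1 u1 e1)
    then have s1: "keep (Suc L) s s1" "\<And>i. i < n \<Longrightarrow> F s1 i" "o1 = []" "u1 \<le> 12 + n * 415" "e1 = 0"
      by auto
    have Lev1: "s1 (Lev, 0, 0) = L" using keepD[OF s1(1)] s by auto
    define s2 where "s2 = s1((Lev, 0, 0) := Suc L)"
    have k2: "keep (Suc L) (s((Lev, 0, 0) := Suc L)) s2"
      using s1(1) unfolding s2_def keep_def by auto
    have "F s2 i" if "i < n" for i using s1(2)[OF that] unfolding F_def s2_def by simp
    note c1 = call1[OF k2 this[unfolded F_def]]
    have first: "wp n subroutine_B Call s2 Q"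
      if "\<And>s3 u e. u \<le> t1 \<Longrightarrow> e \<le> d1 \<Longrightarrow> keep (Suc L) s2 s3 \<Longrightarrow> Q s3 out1 u e" for Q
      by (rule wp_mono[OF c1]) (use that in auto)
    show ?case
    proof (subst wp_Assign, simp add: Lev1 Suc_leI s(3) flip: s2_def, rule first, goal_cases)
      case (1 s3 u3 e3)
      have Lev3: "s3 (Lev, 0, 0) = Suc L" "s3 (ArrV, L, 0) = v"
        using keepD[OF 1(3), of Lev] keepD[OF 1(3), of ArrV L] keepD[OF k2, of ArrV L] s
        by (auto simp: s2_def)
      define s4 where "s4 = s3((Lev, 0, 0) := L, (ArrY, L, v) := 0, (ArrA, L, v) := 0, (ArrB, L, v) := 0)"
      let ?s0 = "s((ArrY, L, v) := 0, (ArrA, L, v) := 0, (ArrB, L, v) := 0)"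
      \<comment> \<open>\<open>Lev\<close> has been raised and lowered again, and the first call has
        touched only \<open>I\<close> and rows above \<open>L\<close>. Up to these, the store is
        \<open>s\<close> with the entries of \<open>v\<close> cleared, which is what
        \<open>call2\<close> expects.\<close>
      have k4: "keep (Suc L) ?s0 s4"
        using 1(3) k2 s unfolding s4_def keep_def by auto
      have "keep L s ?s0" by (simp add: keep_upd)
      then have k: "keep L s s5" if "keep L s4 s5" for s5
        using keep_trans[OF keep_trans[OF _ k4] that] by simp
      have second: "wp n subroutine_B Call s4 Q"
        if "\<And>s5 u e. u \<le> t2 \<Longrightarrow> e \<le> d2 \<Longrightarrow> keep L s4 s5 \<Longrightarrow> Q s5 out2 u e" for Q
        by (rule wp_mono[OF call2[OF k4]]) (use that in auto)
      show ?case
        by (simp add: wp_Assign Lev3 less_imp_le s(3,5) flip: s4_def, rule second)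
          (use s1 1 n k in auto)
    qed
  qed
qed

section \<open>Scanning a row for its last or first entry\<close>

primrec last_below :: "(nat \<Rightarrow> bool) \<Rightarrow> nat \<Rightarrow> nat \<Rightarrow> nat" where
  "last_below P w 0 = w"
| "last_below P w (Suc k) = (if P k then k else last_below P w k)"

text \<open>Both functions give the content of the \<open>ArrV\<close> cell after \<open>k\<close>
  rounds, where \<open>w\<close>, which is no position, means that nothing has been found. The test
  for \<open>w\<close> mirrors the program, which stores a position only while the cell still has
  this default.\<close>

primrec first_below :: "(nat \<Rightarrow> bool) \<Rightarrow> nat \<Rightarrow> nat \<Rightarrow> nat" where
  "first_below P w 0 = w"
| "first_below P w (Suc k) = (if P k \<and> first_below P w k = w then k else first_below P w k)"

lemma last_below_eq:
  "last_below P w k = (if \<exists>i<k. P i then Max {i. i < k \<and> P i} else w)"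
proof (induction k)
  case (Suc k)
  show ?case
  proof (cases "P k")
    case True
    then have "Max {i. i < Suc k \<and> P i} = k" by (intro Max_eqI) auto
    then show ?thesis using True by auto
  next
    case False
    then have "{i. i < Suc k \<and> P i} = {i. i < k \<and> P i}" by (auto simp: less_Suc_eq)
    moreover have "(\<exists>i<Suc k. P i) \<longleftrightarrow> (\<exists>i<k. P i)" using False by (auto simp: less_Suc_eq)
    ultimately show ?thesis by (simp only: last_below.simps False if_False Suc.IH)
  qed
qed simp

text \<open>The condition \<open>k \<le> w\<close> keeps a position that was found distinct from the
  default \<open>w\<close>.\<close>

lemma first_below_eq:
  "k \<le> w \<Longrightarrow> first_below P w k = (if \<exists>i<k. P i then Min {i. i < k \<and> P i} else w)"
proof (induction k)
  case (Suc k)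
  show ?case
  proof (cases "\<exists>i<k. P i")
    case True
    let ?M = "Min {i. i < k \<and> P i}"
    have M: "?M \<in> {i. i < k \<and> P i}" using True by (intro Min_in) auto
    have "?M \<le> i" if "i < Suc k" "P i" for i
      using that M by (cases "i = k") auto
    then have "Min {i. i < Suc k \<and> P i} = ?M" using M by (intro Min_eqI) auto
    moreover have "\<exists>i<Suc k. P i" using True less_SucI by blast
    ultimately show ?thesis using True M Suc by auto
  next
    case False
    then have "Min {i. i < Suc k \<and> P i} = k" if "P k"
      using that by (intro Min_eqI) (auto simp: less_Suc_eq)
    then show ?thesis using False Suc by (auto simp: less_Suc_eq)
  qed
qed simp

lemma last_below_last_in:
  assumes "\<And>i. i < length vs \<Longrightarrow> P i \<longleftrightarrow> vs ! i \<in> A" "A \<subseteq> set vs"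
  defines "l \<equiv> last_below P (length vs) (length vs)"
  shows "A = {} \<Longrightarrow> l = length vs" and "A \<noteq> {} \<Longrightarrow> l < length vs \<and> vs ! l = last_in vs A"
proof -
  have eq: "{i. i < length vs \<and> P i} = {i. i < length vs \<and> vs ! i \<in> A}" using assms by auto
  show "l = length vs" if "A = {}" using that assms(1) by (auto simp: l_def last_below_eq)
  show "l < length vs \<and> vs ! l = last_in vs A" if "A \<noteq> {}"
  proof -
    obtain x where "x \<in> A" "x \<in> set vs" using \<open>A \<noteq> {}\<close> assms(2) by auto
    then obtain i where i: "i < length vs" "P i" using assms(1) by (auto simp: in_set_conv_nth)
    then have "Max {i. i < length vs \<and> P i} \<in> {i. i < length vs \<and> P i}" by (intro Max_in) auto
    then show ?thesis using i unfolding l_def last_in_def last_below_eq eq[symmetric] by auto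
  qed
qed

lemma first_below_first_in:
  assumes "\<And>i. i < length vs \<Longrightarrow> P i \<longleftrightarrow> vs ! i \<in> A" "A \<subseteq> set vs"
  defines "l \<equiv> first_below P (length vs) (length vs)"
  shows "A = {} \<Longrightarrow> l = length vs" and "A \<noteq> {} \<Longrightarrow> l < length vs \<and> vs ! l = first_in vs A"
proof -
  have eq: "{i. i < length vs \<and> P i} = {i. i < length vs \<and> vs ! i \<in> A}" using assms by auto
  show "l = length vs" if "A = {}" using that assms(1) by (auto simp: l_def first_below_eq)
  show "l < length vs \<and> vs ! l = first_in vs A" if "A \<noteq> {}"
  proof -
    obtain x where "x \<in> A" "x \<in> set vs" using \<open>A \<noteq> {}\<close> assms(2) by auto
    then obtain i where i: "i < length vs" "P i" using assms(1) by (auto simp: in_set_conv_nth)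
    then have "Min {i. i < length vs \<and> P i} \<in> {i. i < length vs \<and> P i}" by (intro Min_in) auto
    then show ?thesis using i unfolding l_def first_in_def first_below_eq[OF order_refl] eq[symmetric] by auto
  qed
qed

section \<open>Updating neighbourhoods when the set grows by \<open>R\<close>\<close>

lemma nbrs_update:
  assumes "trans r" "X \<inter> Y = {}" and A: "A = (r `` X - X) \<inter> Y" and B: "B = (r\<inverse> `` X - X) \<inter> Y"
    and v: "v \<in> A" and R: "R = {v} \<union> (r\<inverse> `` {v} \<inter> A)"
  shows "(r `` (X \<union> R) - (X \<union> R)) \<inter> (Y - R) = A \<inter> (Y - R)"
    and "(r\<inverse> `` (X \<union> R) - (X \<union> R)) \<inter> (Y - R) = (B \<union> r\<inverse> `` {v}) \<inter> (Y - R)"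
proof -
  \<comment> \<open>\<open>R\<close> consists of successors of \<open>X\<close>, so by transitivity
    its successors are successors of \<open>X\<close> already.\<close>
  have "R \<subseteq> r `` X" using A v R by auto
  then have "r `` R \<subseteq> r `` X" using \<open>trans r\<close> by (fastforce dest: transD)
  then show "(r `` (X \<union> R) - (X \<union> R)) \<inter> (Y - R) = A \<inter> (Y - R)"
    using A by (auto simp del: Image_iff simp: Image_Un)
  \<comment> \<open>The other elements of \<open>R\<close> precede \<open>v\<close>, so their
    predecessors are predecessors of \<open>v\<close>.\<close>
  have "r\<inverse> `` R = r\<inverse> `` {v}" using R \<open>trans r\<close> by (auto dest: transD)
  then show "(r\<inverse> `` (X \<union> R) - (X \<union> R)) \<inter> (Y - R) = (B \<union> r\<inverse> `` {v}) \<inter> (Y - R)"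
    using B assms(2) by (auto simp del: Image_iff simp: Image_Un)
qed

lemma out_nbrs_update:
  assumes "trans (parcs T)" "X \<inter> Y = {}" "v \<in> out_nbrs_set T X \<inter> Y"
    and R: "R = {v} \<union> (in_nbrs T v \<inter> (out_nbrs_set T X \<inter> Y))"
  shows "out_nbrs_set T (X \<union> R) \<inter> (Y - R) = out_nbrs_set T X \<inter> Y \<inter> (Y - R)"
    and "in_nbrs_set T (X \<union> R) \<inter> (Y - R) = (in_nbrs_set T X \<inter> Y \<union> in_nbrs T v) \<inter> (Y - R)"
proof -
  have in_v: "in_nbrs T v = (parcs T)\<inverse> `` {v}" by (auto simp: in_nbrs_def)
  show "out_nbrs_set T (X \<union> R) \<inter> (Y - R) = out_nbrs_set T X \<inter> Y \<inter> (Y - R)"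
    and "in_nbrs_set T (X \<union> R) \<inter> (Y - R) = (in_nbrs_set T X \<inter> Y \<union> in_nbrs T v) \<inter> (Y - R)"
    using nbrs_update[OF assms(1,2) refl refl assms(3)[unfolded out_nbrs_set_Image]
        R[unfolded in_v out_nbrs_set_Image]]
    unfolding out_nbrs_set_Image in_nbrs_set_Image in_v by blast+
qed

lemma in_nbrs_update:
  assumes "trans (parcs T)" "X \<inter> Y = {}" "v \<in> in_nbrs_set T X \<inter> Y"
    and R: "R = {v} \<union> (out_nbrs T v \<inter> (in_nbrs_set T X \<inter> Y))"
  shows "in_nbrs_set T (X \<union> R) \<inter> (Y - R) = in_nbrs_set T X \<inter> Y \<inter> (Y - R)"
    and "out_nbrs_set T (X \<union> R) \<inter> (Y - R) = (out_nbrs_set T X \<inter> Y \<union> out_nbrs T v) \<inter> (Y - R)"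
proof -
  have out_v: "out_nbrs T v = ((parcs T)\<inverse>)\<inverse> `` {v}" by (auto simp: out_nbrs_def)
  have "trans ((parcs T)\<inverse>)" using assms(1) by simp
  note update = nbrs_update[OF this assms(2) refl refl assms(3)[unfolded in_nbrs_set_Image]
        R[unfolded out_v in_nbrs_set_Image]]
  show "in_nbrs_set T (X \<union> R) \<inter> (Y - R) = in_nbrs_set T X \<inter> Y \<inter> (Y - R)"
    and "out_nbrs_set T (X \<union> R) \<inter> (Y - R) = (out_nbrs_set T X \<inter> Y \<union> out_nbrs T v) \<inter> (Y - R)"
    using update unfolding out_nbrs_set_Image in_nbrs_set_Image out_v converse_converse by blast+
qed

section \<open>The machine subroutine against the abstract recursion\<close>

lemma printed_append: "printed (xs @ ys) = printed xs @ printed ys"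
  by (simp add: printed_def)

text \<open>Two numberings coexist: rows are indexed by positions in \<open>vs\<close>, the matrix
  and the printed output by input numbers. \<open>pos\<close> translates the former into the latter
  and is the content of \<open>Ord\<close>.\<close>

locale subroutine =
  fixes T :: "'a pair_pre_digraph" and vs :: "'a list" and pos :: "nat \<Rightarrow> nat" and n :: nat
  assumes n: "n = length vs" and trans: "trans (parcs T)" and ordering: "acyclic_ordering T vs"
    and pos: "\<And>i. i < n \<Longrightarrow> pos i < n"
begin

definition env :: "reg store \<Rightarrow> bool" where
  "env s \<longleftrightarrow> s (Num, 0, 0) = n \<and> (\<forall>i<n. s (Ord, i, 0) = pos i) \<and>
     (\<forall>i<n. \<forall>j<n. s (Adj, pos i, pos j) \<noteq> 0 \<longleftrightarrow> (vs ! i, vs ! j) \<in> parcs T)"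

definition rows :: "reg store \<Rightarrow> nat \<Rightarrow> 'a set \<Rightarrow> 'a set \<Rightarrow> bool" where
  "rows s L X Y \<longleftrightarrow> (\<forall>i<n. (s (ArrX, L, i) \<noteq> 0 \<longleftrightarrow> vs ! i \<in> X) \<and> (s (ArrY, L, i) \<noteq> 0 \<longleftrightarrow> vs ! i \<in> Y) \<and>
     (s (ArrA, L, i) \<noteq> 0 \<longleftrightarrow> vs ! i \<in> out_nbrs_set T X \<inter> Y) \<and>
     (s (ArrB, L, i) \<noteq> 0 \<longleftrightarrow> vs ! i \<in> in_nbrs_set T X \<inter> Y))"

definition enc :: "'a set \<Rightarrow> nat list" where
  "enc X = map pos (filter (\<lambda>i. vs ! i \<in> X) [0..<n])"

lemma env_keep: "keep L s s' \<Longrightarrow> env s \<Longrightarrow> env s'"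
  unfolding env_def keep_def by auto

lemma wp_find_last:
  assumes s: "s (Num, 0, 0) = n" "s (Lev, 0, 0) = L" "L < n" "s (ArrV, L, 0) = n"
  shows "wp n body (FOR I BELOW \<section>Num DO
       IF ArrA\<langle>\<section>Lev, \<section>I\<rangle> THEN ArrV\<langle>\<section>Lev, Const 0\<rangle> ::= \<section>I ELSE Skip) s
    (\<lambda>s' out t d. out = [] \<and> t \<le> 12 + n * 65 \<and> d = 0 \<and>
      s' (ArrV, L, 0) = last_below (\<lambda>i. s (ArrA, L, i) \<noteq> 0) n n \<and>
      (\<forall>c. c \<noteq> (I, 0, 0) \<longrightarrow> c \<noteq> (ArrV, L, 0) \<longrightarrow> s' c = s c))"
proof (rule wp_For_const[where T = 50 and Inv = "\<lambda>k s' out. out = [] \<and>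
      s' (ArrV, L, 0) = last_below (\<lambda>i. s (ArrA, L, i) \<noteq> 0) n k \<and>
      (\<forall>c. c \<noteq> (I, 0, 0) \<longrightarrow> c \<noteq> (ArrV, L, 0) \<longrightarrow> s' c = s c)"], goal_cases)
  case (4 k s1 out)
  then have "s1 (Lev, 0, 0) = L" "s1 (ArrA, L, k) = s (ArrA, L, k)" using s by auto
  then show ?case using 4 s by (auto simp: wp_simps)
qed (use s in auto)

lemma wp_find_first:
  assumes s: "s (Num, 0, 0) = n" "s (Lev, 0, 0) = L" "L < n" "s (ArrV, L, 0) = n"
  shows "wp n body (FOR I BELOW \<section>Num DO
         IF And (ArrB\<langle>\<section>Lev, \<section>I\<rangle>) (Eq cur_v (\<section>Num))
         THEN ArrV\<langle>\<section>Lev, Const 0\<rangle> ::= \<section>I ELSE Skip) s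
    (\<lambda>s' out t d. out = [] \<and> t \<le> 12 + n * 65 \<and> d = 0 \<and>
      s' (ArrV, L, 0) = first_below (\<lambda>i. s (ArrB, L, i) \<noteq> 0) n n \<and>
      (\<forall>c. c \<noteq> (I, 0, 0) \<longrightarrow> c \<noteq> (ArrV, L, 0) \<longrightarrow> s' c = s c))"
proof (rule wp_For_const[where T = 50 and Inv = "\<lambda>k s' out. out = [] \<and>
      s' (ArrV, L, 0) = first_below (\<lambda>i. s (ArrB, L, i) \<noteq> 0) n k \<and>
      (\<forall>c. c \<noteq> (I, 0, 0) \<longrightarrow> c \<noteq> (ArrV, L, 0) \<longrightarrow> s' c = s c)"], goal_cases)
  case (4 k s1 out)
  then have "s1 (Lev, 0, 0) = L" "s1 (ArrB, L, k) = s (ArrB, L, k)" using s by auto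
  then show ?case using 4 s by (auto simp: wp_simps)
qed (use s in auto)

lemma wp_print:
  assumes s: "env s" "rows s L X Y" "s (Lev, 0, 0) = L" "L < n"
  shows "wp n body (FOR I BELOW \<section>Num DO
           IF ArrX\<langle>\<section>Lev, \<section>I\<rangle> THEN Print (Ord\<langle>\<section>I, Const 0\<rangle>) ELSE Skip) s
    (\<lambda>s' out t d. out = map Some (enc X) \<and> t \<le> 12 + n * 65 \<and> d = 0 \<and> keep L s s')"
proof (rule wp_For_const[where T = 50 and Inv = "\<lambda>k s' out.
      out = map Some (map pos (filter (\<lambda>i. vs ! i \<in> X) [0..<k])) \<and>
      (\<forall>c. c \<noteq> (I, 0, 0) \<longrightarrow> s' c = s c)"], goal_cases)
  case (4 k s1 out)
  then have "s1 (Lev, 0, 0) = L" "s1 (ArrX, L, k) = s (ArrX, L, k)" "s1 (Ord, k, 0) = pos k"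
    using s by (auto simp: env_def)
  moreover have "s (ArrX, L, k) \<noteq> 0 \<longleftrightarrow> vs ! k \<in> X" using s 4 by (auto simp: rows_def)
  ultimately show ?case using 4 s by (auto simp: wp_simps)
qed (use s in \<open>auto simp: env_def enc_def keep_def\<close>)

text \<open>\<open>X\<close> itself is always among the outputs. This keeps the potential
  \<open>4000 * n * k - 2000 * n\<close> from being truncated at 0.\<close>

lemma alg_B_nonempty:
  assumes "B_inv (parcs T) X Y" "Y \<subseteq> set vs"
  shows "1 \<le> length (alg_B T vs X Y)"
proof -
  have "X \<in> set (alg_B T vs X Y)"
    using alg_B_correct[OF trans ordering assms] assms(1) by (auto simp: B_inv_def)
  then show ?thesis by (cases "alg_B T vs X Y") auto
qed

text \<open>The summand \<open>2000 * n\<close> on the left strengthens the bound enough to pass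
  through two recursive calls. The first call raises the level but takes at least \<open>v\<close>
  out of \<open>Y\<close>, so \<open>L + card Y < n\<close> persists and row indices fit into words;
  the same decrease bounds the depth of pending calls.\<close>

lemma wp_B:
  "B_inv (parcs T) X Y \<Longrightarrow> Y \<subseteq> set vs \<Longrightarrow> env s \<Longrightarrow> rows s L X Y \<Longrightarrow> s (Lev, 0, 0) = L \<Longrightarrow>
    L + card Y < n \<Longrightarrow>
    wp n subroutine_B Call s (\<lambda>s' out t d. out = printed (map enc (alg_B T vs X Y)) \<and>
      t + 2000 * n \<le> 4000 * n * length (alg_B T vs X Y) \<and> d \<le> Suc (card Y) \<and> keep L s s')"
proof (induction "card Y" arbitrary: X Y s L rule: less_induct)
  case less
  note inv = less.prems(1) and Y = less.prems(2) and s = less.prems(3-6)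
  let ?A = "out_nbrs_set T X \<inter> Y" and ?B = "in_nbrs_set T X \<inter> Y"
  have finY: "finite Y" using Y finite_subset by auto
  have n1: "1 \<le> n" "L < n" using s(4) by auto
  have dist: "distinct vs" using ordering by (simp add: acyclic_ordering_def)
  \<comment> \<open>The reserve of \<open>3000 * n\<close> exceeds the \<open>2000 * n\<close> of
    the goal by what the scans for \<open>v\<close>, the tests and the call itself may cost.\<close>
  have branch: "wp n subroutine_B (branch inR newA newB) s1 (\<lambda>s' out t d.
      out = printed (map enc (alg_B T vs X Y)) \<and>
      t + 3000 * n \<le> 4000 * n * length (alg_B T vs X Y) \<and> d \<le> card Y \<and> keep L s1 s')"
    if s1: "env s1" "rows s1 L X Y" "s1 (Lev, 0, 0) = L" "s1 (ArrV, L, 0) = iv" "iv < n"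
      and ops: "ops (inR (\<section>I)) \<le> 40" "ops (newA (\<section>I)) \<le> 40" "ops (newB (\<section>I)) \<le> 40"
      and ev: "\<And>e p s'. (e, p) \<in> {(inR, pR), (newA, pA), (newB, pB)} \<Longrightarrow> keep (Suc L) s1 s' \<Longrightarrow>
        s' (I, 0, 0) < n \<Longrightarrow>
        (eval (e (\<section>I)) s' = 0 \<longleftrightarrow> \<not> p (s' (I, 0, 0))) \<and> cells_read (e (\<section>I)) s' \<subseteq> grid n"
      and v: "v = vs ! iv" "v \<in> R" "R \<subseteq> Y"
      and invs: "B_inv (parcs T) (X \<union> R) (Y - R)" "B_inv (parcs T) X (Y - {v})"
      and eq: "alg_B T vs X Y = alg_B T vs (X \<union> R) (Y - R) @ alg_B T vs X (Y - {v})"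
      and pR: "\<And>i. i < n \<Longrightarrow> pR i \<longleftrightarrow> vs ! i \<in> R"
      and pA: "\<And>i. i < n \<Longrightarrow> vs ! i \<in> Y - R \<Longrightarrow> pA i \<longleftrightarrow> vs ! i \<in> out_nbrs_set T (X \<union> R) \<inter> (Y - R)"
      and pB: "\<And>i. i < n \<Longrightarrow> vs ! i \<in> Y - R \<Longrightarrow> pB i \<longleftrightarrow> vs ! i \<in> in_nbrs_set T (X \<union> R) \<inter> (Y - R)"
    for s1 iv inR newA newB and pR pA pB :: "nat \<Rightarrow> bool" and v R
  proof -
    have cards: "card (Y - R) < card Y" "card (Y - {v}) < card Y"
      using v finY by (auto intro!: psubset_card_mono)
    have sub: "Y - R \<subseteq> set vs" "Y - {v} \<subseteq> set vs" using Y by auto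
    let ?o1 = "alg_B T vs (X \<union> R) (Y - R)" and ?o2 = "alg_B T vs X (Y - {v})"
    let ?t1 = "4000 * n * length ?o1 - 2000 * n" and ?t2 = "4000 * n * length ?o2 - 2000 * n"
    have num: "s1 (Num, 0, 0) = n" using s1(1) by (simp add: env_def)
    have "wp n subroutine_B (branch inR newA newB) s1 (\<lambda>s' out t d.
      out = printed (map enc ?o1) @ printed (map enc ?o2) \<and> t \<le> ?t1 + ?t2 + 1000 * n \<and>
      d \<le> max (card Y) (card Y) \<and> keep L s1 s')"
    proof (rule wp_branch[where inR = inR and newA = newA and newB = newB and pR = pR and pA = pA
          and pB = pB, OF num s1(3) n1(2) s1(4,5) _ ops], goal_cases)
      case (1 e p s2)
      then show ?case by (rule ev)
    next
      case (2 s2)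
      have "env (s1((Lev, 0, 0) := Suc L))" using s1(1) by (simp add: env_def)
      then have "env s2" using env_keep[OF 2(1)] by simp
      moreover have "rows s2 (Suc L) (X \<union> R) (Y - R)"
        unfolding rows_def
      proof (intro allI impI)
        fix i assume i: "i < n"
        then have "s1 (ArrX, L, i) \<noteq> 0 \<longleftrightarrow> vs ! i \<in> X" "s1 (ArrY, L, i) \<noteq> 0 \<longleftrightarrow> vs ! i \<in> Y"
          using s1(2) by (auto simp: rows_def)
        then show "(s2 (ArrX, Suc L, i) \<noteq> 0 \<longleftrightarrow> vs ! i \<in> X \<union> R) \<and> (s2 (ArrY, Suc L, i) \<noteq> 0 \<longleftrightarrow> vs ! i \<in> Y - R) \<and>
          (s2 (ArrA, Suc L, i) \<noteq> 0 \<longleftrightarrow> vs ! i \<in> out_nbrs_set T (X \<union> R) \<inter> (Y - R)) \<and>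
          (s2 (ArrB, Suc L, i) \<noteq> 0 \<longleftrightarrow> vs ! i \<in> in_nbrs_set T (X \<union> R) \<inter> (Y - R))"
          using 2(2)[OF i] pR[OF i] pA[OF i] pB[OF i] by blast
      qed
      moreover have "s2 (Lev, 0, 0) = Suc L" using keepD[OF 2(1), of Lev] by simp
      ultimately have "wp n subroutine_B Call s2 (\<lambda>s' out t d. out = printed (map enc ?o1) \<and>
        t + 2000 * n \<le> 4000 * n * length ?o1 \<and> d \<le> Suc (card (Y - R)) \<and> keep (Suc L) s2 s')"
        using less.hyps[OF cards(1) invs(1) sub(1), of s2 "Suc L"] cards s(4) by simp
      then show ?case by (rule wp_mono) (use cards in auto)
    next
      case (3 s2)
      let ?s = "s1((ArrY, L, iv) := 0, (ArrA, L, iv) := 0, (ArrB, L, iv) := 0)"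
      have "env ?s" using s1(1) by (simp add: env_def)
      then have "env s2" using env_keep[OF 3] by simp
      \<comment> \<open>\<open>X\<close> is unchanged, so \<open>A\<close> and \<open>B\<close> lose
        nothing but \<open>v\<close>; as \<open>vs\<close> is distinct, this is the single entry at
        \<open>iv\<close>.\<close>
      moreover have "rows s2 L X (Y - {v})"
        unfolding rows_def
      proof (intro allI impI)
        fix i assume i: "i < n"
        have "s2 (a, L, i) = ?s (a, L, i)" if "a \<in> {ArrX, ArrY, ArrA, ArrB}" for a
          using keepD[OF 3, of a L i] that by auto
        then have "s2 (ArrX, L, i) = s1 (ArrX, L, i)"
          "s2 (ArrY, L, i) = (if i = iv then 0 else s1 (ArrY, L, i))"
          "s2 (ArrA, L, i) = (if i = iv then 0 else s1 (ArrA, L, i))"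
          "s2 (ArrB, L, i) = (if i = iv then 0 else s1 (ArrB, L, i))" by auto
        moreover have "vs ! i = v \<longleftrightarrow> i = iv"
          using dist i s1(5) n v(1) by (simp add: nth_eq_iff_index_eq)
        ultimately show "(s2 (ArrX, L, i) \<noteq> 0 \<longleftrightarrow> vs ! i \<in> X) \<and> (s2 (ArrY, L, i) \<noteq> 0 \<longleftrightarrow> vs ! i \<in> Y - {v}) \<and>
          (s2 (ArrA, L, i) \<noteq> 0 \<longleftrightarrow> vs ! i \<in> out_nbrs_set T X \<inter> (Y - {v})) \<and>
          (s2 (ArrB, L, i) \<noteq> 0 \<longleftrightarrow> vs ! i \<in> in_nbrs_set T X \<inter> (Y - {v}))"
          using s1(2) i unfolding rows_def by auto
      qed
      moreover have "s2 (Lev, 0, 0) = L" using keepD[OF 3, of Lev] s1(3) by simp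
      ultimately have "wp n subroutine_B Call s2 (\<lambda>s' out t d. out = printed (map enc ?o2) \<and>
        t + 2000 * n \<le> 4000 * n * length ?o2 \<and> d \<le> Suc (card (Y - {v})) \<and> keep L s2 s')"
        using less.hyps[OF cards(2) invs(2) sub(2), of s2 L] cards s(4) by simp
      then show ?case by (rule wp_mono) (use cards in auto)
    qed
    then show ?thesis
    proof (rule wp_mono, goal_cases)
      case (1 s' out t d)
      have "2000 * n \<le> 4000 * n * length ?o1" "2000 * n \<le> 4000 * n * length ?o2"
        using alg_B_nonempty[OF invs(1) sub(1)] alg_B_nonempty[OF invs(2) sub(2)]
          mult_le_mono2[of 1 "length ?o1" "4000 * n"] mult_le_mono2[of 1 "length ?o2" "4000 * n"] by linarith+
      then have "?t1 + ?t2 + 1000 * n + 3000 * n \<le> 4000 * n * length ?o1 + 4000 * n * length ?o2" by linarith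
      also have "\<dots> = 4000 * n * length (alg_B T vs X Y)" unfolding eq by (simp add: algebra_simps)
      finally show ?case using 1 unfolding eq by (simp add: printed_append)
    qed
  qed
  define s0 where "s0 = s((ArrV, L, 0) := n)"
  have num: "s (Num, 0, 0) = n" using s(1) by (simp add: env_def)
  have s0: "s0 (Num, 0, 0) = n" "s0 (Lev, 0, 0) = L" "s0 (ArrV, L, 0) = n"
    using num s(3) by (simp_all add: s0_def)
  have frame: "env s1 \<and> rows s1 L X Y \<and> s1 (Lev, 0, 0) = L \<and> keep L s s1 \<and> s1 (Num, 0, 0) = n"
    if "\<forall>c. c \<noteq> (I, 0, 0) \<longrightarrow> c \<noteq> (ArrV, L, 0) \<longrightarrow> s1 c = s c" for s1
  proof -
    have k: "keep L s s1" using that unfolding keep_def by auto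
    moreover have "rows s1 L X Y" using s(2) that unfolding rows_def by auto
    ultimately show ?thesis using env_keep[OF k s(1)] s(3) that num by auto
  qed
  have ev: "s' (Lev, 0, 0) = L" "s' (ArrV, L, 0) = s1 (ArrV, L, 0)" "s' (Num, 0, 0) = n"
    "\<And>i. i < n \<Longrightarrow> s' (Ord, i, 0) = pos i"
    "\<And>i. i < n \<Longrightarrow> s' (ArrA, L, i) = 0 \<longleftrightarrow> vs ! i \<notin> ?A"
    "\<And>i. i < n \<Longrightarrow> s' (ArrB, L, i) = 0 \<longleftrightarrow> vs ! i \<notin> ?B"
    "\<And>i j. i < n \<Longrightarrow> j < n \<Longrightarrow> s' (Adj, pos i, pos j) = 0 \<longleftrightarrow> (vs ! i, vs ! j) \<notin> parcs T"
    if "env s1" "rows s1 L X Y" "s1 (Lev, 0, 0) = L" "keep (Suc L) s1 s'" for s1 s'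
  proof -
    have e: "env s'" using env_keep[OF that(4,1)] .
    have row: "s' (a, L, i) = s1 (a, L, i)" if "a \<noteq> I" for a i
      using keepD[OF \<open>keep (Suc L) s1 s'\<close> that, of L i] by simp
    show "s' (Lev, 0, 0) = L" using keepD[OF that(4), of Lev] that(3) by simp
    show "s' (ArrV, L, 0) = s1 (ArrV, L, 0)" by (simp add: row)
    show "s' (Num, 0, 0) = n" "\<And>i. i < n \<Longrightarrow> s' (Ord, i, 0) = pos i" using e by (simp_all add: env_def)
    show "s' (ArrA, L, i) = 0 \<longleftrightarrow> vs ! i \<notin> ?A" "s' (ArrB, L, i) = 0 \<longleftrightarrow> vs ! i \<notin> ?B" if "i < n" for i
      using \<open>rows s1 L X Y\<close> that row[of ArrA i] row[of ArrB i] unfolding rows_def by auto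
    show "s' (Adj, pos i, pos j) = 0 \<longleftrightarrow> (vs ! i, vs ! j) \<notin> parcs T" if "i < n" "j < n" for i j
      using e that unfolding env_def by metis
  qed
  have sub: "?A \<subseteq> set vs" "?B \<subseteq> set vs" using Y by auto
  have disj: "X \<inter> Y = {}" using inv by (simp add: B_inv_def)
  have pos': "pos i \<le> n" if "i < n" for i using pos[OF that] by simp
  let ?Q = "\<lambda>s' out t d. out = printed (map enc (alg_B T vs X Y)) \<and>
      t + 2000 * n \<le> 4000 * n * length (alg_B T vs X Y) \<and> d \<le> Suc (card Y) \<and> keep L s s'"
  \<comment> \<open>Hides the procedure body from the unfolding of \<open>subroutine_B_def\<close>,
    which is meant for the executed command only.\<close>
  define body where "body = subroutine_B"
  note branch' = branch[folded body_def]
  have "wp n body subroutine_B s (\<lambda>s' out t d. ?Q s' out (1 + t) (Suc d))"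
    unfolding subroutine_B_def wp_Seq
  proof (subst wp_Assign, simp add: s(3) num n1 less_imp_le flip: s0_def,
      rule wp_mono[OF wp_find_last[OF s0(1,2) n1(2) s0(3)]], goal_cases)
    case (1 s1 o1 u1 e1)
    have fr: "\<forall>c. c \<noteq> (I, 0, 0) \<longrightarrow> c \<noteq> (ArrV, L, 0) \<longrightarrow> s1 c = s c" using 1 by (simp add: s0_def)
    have u1: "u1 \<le> 12 + n * 65" "o1 = []" "e1 = 0" using 1 by auto
    note f1 = frame[OF fr]
    have PA: "s0 (ArrA, L, i) \<noteq> 0 \<longleftrightarrow> vs ! i \<in> ?A" if "i < n" for i
      using s(2) that by (simp add: rows_def s0_def)
    let ?l = "last_below (\<lambda>i. s0 (ArrA, L, i) \<noteq> 0) n n"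
    have lb: "?A = {} \<Longrightarrow> ?l = n" "?A \<noteq> {} \<Longrightarrow> ?l < n \<and> vs ! ?l = last_in vs ?A"
      using last_below_last_in[of vs _ ?A, folded n, OF PA sub(1)] by blast+
    have V1: "s1 (ArrV, L, 0) = last_below (\<lambda>i. s0 (ArrA, L, i) \<noteq> 0) n n" using 1 by simp
    show ?case
    proof (cases "?A = {}")
      case False
      define iv where "iv = s1 (ArrV, L, 0)"
      define v where "v = vs ! iv"
      define R where "R = {v} \<union> (in_nbrs T v \<inter> ?A)"
      have iv: "iv < n" "v = last_in vs ?A" using lb(2)[OF False] V1 by (auto simp: iv_def v_def)
      note step = B_inv_out_step[OF trans ordering inv Y refl False iv(2) R_def]
      note upd = out_nbrs_update[OF trans disj step(1) R_def]
      have veq: "i < n \<Longrightarrow> vs ! i = v \<longleftrightarrow> i = iv" for i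
        using dist iv(1) n by (simp add: v_def nth_eq_iff_index_eq)
      let ?pR = "\<lambda>i. i = iv \<or> vs ! i \<in> ?A \<and> (vs ! i, v) \<in> parcs T"
      let ?pA = "\<lambda>i. vs ! i \<in> ?A"
      let ?pB = "\<lambda>i. vs ! i \<in> ?B \<or> (vs ! i, v) \<in> parcs T"
      have br: "wp n body (branch
         (\<lambda>i. Or (Eq i cur_v) (And (ArrA\<langle>\<section>Lev, i\<rangle>) (ord_arc i cur_v)))
         (\<lambda>i. ArrA\<langle>\<section>Lev, i\<rangle>)
         (\<lambda>i. Or (ArrB\<langle>\<section>Lev, i\<rangle>) (ord_arc i cur_v))) s1 (\<lambda>s' out t d.
          out = printed (map enc (alg_B T vs X Y)) \<and>
          t + 3000 * n \<le> 4000 * n * length (alg_B T vs X Y) \<and> d \<le> card Y \<and> keep L s1 s')"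
        (is "wp n body (branch ?eR ?eA ?eB) s1 _")
      proof (rule branch'[where iv = iv and v = v and R = R and
            pR = ?pR and pA = ?pA and pB = ?pB], goal_cases)
        case (9 e p s')
        have k: "keep (Suc L) s1 s'" "s' (I, 0, 0) < n" using 9 by auto
        have pre: "env s1" "rows s1 L X Y" "s1 (Lev, 0, 0) = L" using f1 by auto
        note evs = ev[OF pre k(1), folded iv_def]
        consider "e = ?eR" "p = ?pR" | "e = ?eA" "p = ?pA" | "e = ?eB" "p = ?pB" using 9(1) by auto
        then show ?case
          by cases (simp_all add: evs(1-4) evs(5,6)[OF k(2)] evs(7)[OF k(2) iv(1)] evs(7)[OF iv(1) k(2)] k(2)
            iv(1) n1 less_imp_le pos' v_def del: Int_iff)
      next
        case (16 i)
        then show ?case using veq[of i] by (auto simp: R_def in_nbrs_def)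
      next
        case (17 i)
        then show ?case unfolding upd by auto
      next
        case (18 i)
        then show ?case unfolding upd by (auto simp: in_nbrs_def)
      qed (use f1 iv step alg_B_out[OF Y refl False iv(2) R_def] in \<open>auto simp: iv_def v_def R_def\<close>)
      show ?thesis
        by (simp add: wp_If f1 iv(1)[unfolded iv_def] n1 less_imp_le, rule wp_mono[OF br])
          (use u1 n1 f1 keep_trans[of L s s1 L] in auto)
    next
      case True
      then have V1: "s1 (ArrV, L, 0) = n" using lb(1) V1 by simp
      have s1: "s1 (Num, 0, 0) = n" "s1 (Lev, 0, 0) = L" using f1 by auto
      show ?thesis
      proof (simp add: wp_If wp_Seq f1 V1 n1 less_imp_le,
          rule wp_mono[OF wp_find_first[OF s1 n1(2) V1]], goal_cases)
        case (1 s2 o2 u2 e2)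
        have fr2: "\<forall>c. c \<noteq> (I, 0, 0) \<longrightarrow> c \<noteq> (ArrV, L, 0) \<longrightarrow> s2 c = s c" using 1 fr by simp
        have u2: "u2 \<le> 12 + n * 65" "o2 = []" "e2 = 0" using 1 by auto
        note f2 = frame[OF fr2]
        have PB: "s1 (ArrB, L, i) \<noteq> 0 \<longleftrightarrow> vs ! i \<in> ?B" if "i < n" for i
          using f1 that by (simp add: rows_def)
        let ?l = "first_below (\<lambda>i. s1 (ArrB, L, i) \<noteq> 0) n n"
        have fb: "?B = {} \<Longrightarrow> ?l = n" "?B \<noteq> {} \<Longrightarrow> ?l < n \<and> vs ! ?l = first_in vs ?B"
          using first_below_first_in[of vs _ ?B, folded n, OF PB sub(2)] by blast+
        have V2: "s2 (ArrV, L, 0) = first_below (\<lambda>i. s1 (ArrB, L, i) \<noteq> 0) n n" using 1 by simp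
        show ?case
        proof (cases "?B = {}")
          case False
          define iv where "iv = s2 (ArrV, L, 0)"
          define v where "v = vs ! iv"
          define R where "R = {v} \<union> (out_nbrs T v \<inter> ?B)"
          have iv: "iv < n" "v = first_in vs ?B" using fb(2)[OF False] V2 by (auto simp: iv_def v_def)
          note step = B_inv_in_step[OF trans ordering inv Y refl False iv(2) R_def]
          note upd = in_nbrs_update[OF trans disj step(1) R_def]
          have veq: "i < n \<Longrightarrow> vs ! i = v \<longleftrightarrow> i = iv" for i
            using dist iv(1) n by (simp add: v_def nth_eq_iff_index_eq)
          let ?pR = "\<lambda>i. i = iv \<or> vs ! i \<in> ?B \<and> (v, vs ! i) \<in> parcs T"
          let ?pA = "\<lambda>i. vs ! i \<in> ?A \<or> (v, vs ! i) \<in> parcs T"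
          let ?pB = "\<lambda>i. vs ! i \<in> ?B"
          have br: "wp n body (branch
             (\<lambda>i. Or (Eq i cur_v) (And (ArrB\<langle>\<section>Lev, i\<rangle>) (ord_arc cur_v i)))
             (\<lambda>i. Or (ArrA\<langle>\<section>Lev, i\<rangle>) (ord_arc cur_v i))
             (\<lambda>i. ArrB\<langle>\<section>Lev, i\<rangle>)) s2 (\<lambda>s' out t d.
              out = printed (map enc (alg_B T vs X Y)) \<and>
              t + 3000 * n \<le> 4000 * n * length (alg_B T vs X Y) \<and> d \<le> card Y \<and> keep L s2 s')"
            (is "wp n body (branch ?eR ?eA ?eB) s2 _")
          proof (rule branch'[where iv = iv and v = v and R = R and
                pR = ?pR and pA = ?pA and pB = ?pB], goal_cases)
            case (9 e p s')
            have k: "keep (Suc L) s2 s'" "s' (I, 0, 0) < n" using 9 by auto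
            have pre: "env s2" "rows s2 L X Y" "s2 (Lev, 0, 0) = L" using f2 by auto
        note evs = ev[OF pre k(1), folded iv_def]
        consider "e = ?eR" "p = ?pR" | "e = ?eA" "p = ?pA" | "e = ?eB" "p = ?pB" using 9(1) by auto
        then show ?case
          by cases (simp_all add: evs(1-4) evs(5,6)[OF k(2)] evs(7)[OF k(2) iv(1)] evs(7)[OF iv(1) k(2)] k(2)
            iv(1) n1 less_imp_le pos' v_def del: Int_iff)
          next
            case (16 i)
            then show ?case using veq[of i] by (auto simp: R_def out_nbrs_def)
          next
            case (17 i)
            then show ?case unfolding upd by (auto simp: out_nbrs_def)
          next
            case (18 i)
            then show ?case unfolding upd by auto
          qed (use f2 iv step alg_B_in[OF Y True refl False iv(2) R_def] in \<open>auto simp: iv_def v_def R_def\<close>)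
          show ?thesis
            by (simp add: wp_If f2 iv(1)[unfolded iv_def] n1 less_imp_le, rule wp_mono[OF br])
              (use u1 u2 n1 f2 keep_trans[of L s s2 L] in auto)
        next
          case B: True
          then have V2: "s2 (ArrV, L, 0) = n" using fb(1) V2 by simp
          have s2: "env s2" "rows s2 L X Y" "s2 (Lev, 0, 0) = L" using f2 by auto
          show ?thesis
            by (simp add: wp_If wp_Seq wp_Newline f2 V2 n1 less_imp_le, rule wp_mono[OF wp_print[OF s2 n1(2)]])
              (use u1 u2 n1 f2 keep_trans[of L s s2 L] alg_B_leaf[OF Y True B] in \<open>auto simp: printed_def\<close>)
        qed
      qed
    qed
  qed
  then have "wp n subroutine_B subroutine_B s (\<lambda>s' out t d. ?Q s' out (1 + t) (Suc d))"
    by (simp only: body_def)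
  then show ?case by (simp only: wp_Call)
qed

end

section \<open>Transitive closure and topological sorting\<close>

text \<open>Existence of a nonempty walk from \<open>i\<close> to \<open>j\<close> whose inner
  vertices are all below \<open>k\<close>.\<close>

fun warshall :: "(nat \<Rightarrow> nat \<Rightarrow> bool) \<Rightarrow> nat \<Rightarrow> nat \<Rightarrow> nat \<Rightarrow> bool" where
  "warshall E 0 i j = E i j"
| "warshall E (Suc k) i j = (warshall E k i j \<or> warshall E k i k \<and> warshall E k k j)"

lemma warshall_trans:
  "m < k \<Longrightarrow> warshall E k i m \<Longrightarrow> warshall E k m j \<Longrightarrow> warshall E k i j"
proof (induction k arbitrary: i j m)
  case (Suc k)
  then show ?case by (cases "m = k") (simp, blast, simp, metis less_antisym)
qed simp

lemma warshall_arc: "E i j \<Longrightarrow> warshall E k i j"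
  by (induction k) auto

lemma warshall_trancl:
  assumes us: "set us = V" "r \<subseteq> V \<times> V" and ij: "i < length us" "j < length us" and "distinct us"
    and E: "\<And>i j. i < length us \<Longrightarrow> j < length us \<Longrightarrow> E i j \<longleftrightarrow> (us ! i, us ! j) \<in> r"
  shows "warshall E (length us) i j \<longleftrightarrow> (us ! i, us ! j) \<in> r\<^sup>+"
proof
  have "k \<le> length us \<Longrightarrow> i < length us \<Longrightarrow> j < length us \<Longrightarrow> warshall E k i j \<Longrightarrow> (us ! i, us ! j) \<in> r\<^sup>+"
    for k i j
  proof (induction k arbitrary: i j)
    case 0
    then show ?case using E by auto
  next
    case (Suc k)
    then consider "warshall E k i j" | "warshall E k i k" "warshall E k k j" by auto
    then show ?case
    proof cases
      case 1
      then show ?thesis using Suc by simp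
    next
      case 2
      then have "(us ! i, us ! k) \<in> r\<^sup>+" "(us ! k, us ! j) \<in> r\<^sup>+" using Suc by simp_all
      then show ?thesis by (rule trancl_trans)
    qed
  qed
  then show "(us ! i, us ! j) \<in> r\<^sup>+" if "warshall E (length us) i j" using ij that by blast
  have "y \<in> V \<and> (\<forall>j < length us. us ! j = y \<longrightarrow> warshall E (length us) i j)"
    if "(us ! i, y) \<in> r\<^sup>+" for y
    using that
  proof (induction rule: trancl_induct)
    case (base y)
    then show ?case using us(2) E ij by (auto intro: warshall_arc)
  next
    case (step y z)
    then obtain m where m: "m < length us" "us ! m = y" using us(1) by (auto simp: in_set_conv_nth)
    then have "warshall E (length us) i m" using step by simp
    moreover have "warshall E (length us) m k" if "k < length us" "us ! k = z" for k
      using that step(2) m E by (intro warshall_arc) auto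
    ultimately show ?case using warshall_trans[OF m(1)] step(2) us(2) by blast
  qed
  then show "warshall E (length us) i j" if "(us ! i, us ! j) \<in> r\<^sup>+" using ij that by blast
qed

section \<open>Transitive closure in place on the matrix\<close>

abbreviation adj :: "reg store \<Rightarrow> nat \<Rightarrow> nat \<Rightarrow> bool" where
  "adj s i j \<equiv> s (Adj, i, j) \<noteq> 0"

text \<open>Updating in place is harmless because round \<open>k\<close> fixes the entries it
  consults: setting \<open>(i, k)\<close> requires \<open>adj s i k\<close>, and setting
  \<open>(k, b)\<close> requires \<open>adj s k b\<close>. So the condition may refer to the old
  store \<open>s\<close> throughout.\<close>

lemma wp_step1_J:
  assumes s: "s (Num, 0, 0) = n" "s (K, 0, 0) = k" "s (I, 0, 0) = i" "k < n" "i < n"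
  shows "wp n body (FOR J BELOW \<section>Num DO
       IF And (Adj\<langle>\<section>I, \<section>K\<rangle>) (Adj\<langle>\<section>K, \<section>J\<rangle>) THEN Adj\<langle>\<section>I, \<section>J\<rangle> ::= Const 1 ELSE Skip) s
    (\<lambda>s' out t d. out = [] \<and> t \<le> 12 + n * 45 \<and> d = 0 \<and>
      s' (Num, 0, 0) = n \<and> s' (K, 0, 0) = k \<and> s' (I, 0, 0) = i \<and>
      (\<forall>a b. adj s' a b \<longleftrightarrow> adj s a b \<or> a = i \<and> b < n \<and> adj s i k \<and> adj s k b))"
proof (rule wp_For_const[where T = 30 and Inv = "\<lambda>m s' out. out = [] \<and>
      s' (K, 0, 0) = k \<and> s' (I, 0, 0) = i \<and>
      (\<forall>a b. adj s' a b \<longleftrightarrow> adj s a b \<or> a = i \<and> b < m \<and> adj s i k \<and> adj s k b)"], goal_cases)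
  case (4 m s1 out)
  then have "adj s1 i k \<longleftrightarrow> adj s i k" "adj s1 k m \<longleftrightarrow> adj s k m" by auto
  then show ?case using 4 s by (auto simp: wp_simps less_Suc_eq simp del: neq0_conv)
qed (use s in auto)

lemma wp_step1_I:
  assumes s: "s (Num, 0, 0) = n" "s (K, 0, 0) = k" "k < n"
  shows "wp n body (FOR I BELOW \<section>Num DO FOR J BELOW \<section>Num DO
       IF And (Adj\<langle>\<section>I, \<section>K\<rangle>) (Adj\<langle>\<section>K, \<section>J\<rangle>) THEN Adj\<langle>\<section>I, \<section>J\<rangle> ::= Const 1 ELSE Skip) s
    (\<lambda>s' out t d. out = [] \<and> t \<le> 12 + n * (12 + n * 45 + 15) \<and> d = 0 \<and>
      s' (Num, 0, 0) = n \<and> s' (K, 0, 0) = k \<and>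
      (\<forall>a b. adj s' a b \<longleftrightarrow> adj s a b \<or> a < n \<and> b < n \<and> adj s a k \<and> adj s k b))"
proof (rule wp_For_const[where T = "12 + n * 45" and Inv = "\<lambda>m s' out. out = [] \<and>
      s' (K, 0, 0) = k \<and>
      (\<forall>a b. adj s' a b \<longleftrightarrow> adj s a b \<or> a < m \<and> b < n \<and> adj s a k \<and> adj s k b)"], goal_cases)
  case (4 m s1 out)
  then have "adj s1 m k \<longleftrightarrow> adj s m k" "\<And>b. adj s1 k b \<longleftrightarrow> adj s k b" by auto
  then show ?case
    by (intro wp_mono[OF wp_step1_J[where k = k and i = m]])
      (use 4 s in \<open>auto simp: less_Suc_eq simp del: neq0_conv\<close>)
qed (use s in auto)

lemma wp_step1:
  assumes s: "s (Num, 0, 0) = n"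
  shows "wp n body step1 s (\<lambda>s' out t d. out = [] \<and>
      t \<le> 12 + n * (12 + n * (12 + n * 45 + 15) + 15) \<and> d = 0 \<and> s' (Num, 0, 0) = n \<and>
      (\<forall>i<n. \<forall>j<n. adj s' i j \<longleftrightarrow> warshall (adj s) n i j))"
  unfolding step1_def
proof (rule wp_For_const[where T = "12 + n * (12 + n * 45 + 15)" and
      Inv = "\<lambda>m s' out. out = [] \<and> (\<forall>i<n. \<forall>j<n. adj s' i j \<longleftrightarrow> warshall (adj s) m i j)"], goal_cases)
  case (4 m s1 out)
  then show ?case
    by (intro wp_mono[OF wp_step1_I[where k = m]]) (use 4 s in \<open>auto simp del: neq0_conv\<close>)
qed (use s in auto)

section \<open>Sorting the vertices by in-degree\<close>

definition indeg :: "nat \<Rightarrow> reg store \<Rightarrow> nat \<Rightarrow> nat" where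
  "indeg n s j = length (filter (\<lambda>i. adj s i j) [0..<n])"

lemma wp_degrees_I:
  assumes s: "s (Num, 0, 0) = n" "s (J, 0, 0) = j" "j < n" "s (Deg, j, 0) = 0"
  shows "wp n body (FOR I BELOW \<section>Num DO
         IF Adj\<langle>\<section>I, \<section>J\<rangle> THEN Deg\<langle>\<section>J, Const 0\<rangle> ::= Succ (Deg\<langle>\<section>J, Const 0\<rangle>) ELSE Skip) s
    (\<lambda>s' out t d. out = [] \<and> t \<le> 12 + n * 55 \<and> d = 0 \<and> s' (Deg, j, 0) = indeg n s j \<and>
      (\<forall>c. c \<noteq> (I, 0, 0) \<longrightarrow> c \<noteq> (Deg, j, 0) \<longrightarrow> s' c = s c))"
proof (rule wp_For_const[where T = 40 and Inv = "\<lambda>m s' out. out = [] \<and> s' (Deg, j, 0) = indeg m s j \<and>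
      (\<forall>c. c \<noteq> (I, 0, 0) \<longrightarrow> c \<noteq> (Deg, j, 0) \<longrightarrow> s' c = s c)"], goal_cases)
  case (4 m s1 out)
  then have "s1 (J, 0, 0) = j" "adj s1 m j \<longleftrightarrow> adj s m j" using s by auto
  \<comment> \<open>The counter must fit into a word: before round \<open>m\<close> it is at most
    \<open>m\<close>, so it can still be incremented.\<close>
  moreover have "indeg m s j \<le> m" using length_filter_le[of _ "[0..<m]"] by (simp add: indeg_def)
  ultimately show ?case using 4 s by (auto simp: wp_simps indeg_def simp del: neq0_conv)
qed (use s in \<open>auto simp: indeg_def\<close>)

lemma wp_degrees:
  assumes s: "s (Num, 0, 0) = n"
  shows "wp n body (FOR J BELOW \<section>Num DO
      (Deg\<langle>\<section>J, Const 0\<rangle> ::= Const 0;;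
       FOR I BELOW \<section>Num DO
         IF Adj\<langle>\<section>I, \<section>J\<rangle> THEN Deg\<langle>\<section>J, Const 0\<rangle> ::= Succ (Deg\<langle>\<section>J, Const 0\<rangle>) ELSE Skip)) s
    (\<lambda>s' out t d. out = [] \<and> t \<le> 12 + n * (32 + n * 55 + 15) \<and> d = 0 \<and> s' (Num, 0, 0) = n \<and>
      (\<forall>j<n. s' (Deg, j, 0) = indeg n s j) \<and> (\<forall>i j. s' (Adj, i, j) = s (Adj, i, j)))"
proof (rule wp_For_const[where T = "32 + n * 55" and Inv = "\<lambda>m s' out. out = [] \<and>
      (\<forall>j<m. s' (Deg, j, 0) = indeg n s j) \<and> (\<forall>i j. s' (Adj, i, j) = s (Adj, i, j))"], goal_cases)
  case (4 m s1 out)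
  let ?s = "s1((Deg, m, 0) := 0)"
  have "indeg n ?s m = indeg n s m" using 4 by (simp add: indeg_def)
  then show ?case
    unfolding wp_Seq wp_Assign using 4
    by (simp, intro wp_mono[OF wp_degrees_I[where j = m]]) (auto simp: less_Suc_eq)
qed (use s in auto)

text \<open>The part of \<open>Ord\<close> filled during the sort, when all keys below
  \<open>m\<close> are done and the pass for key \<open>m\<close> has reached vertex
  \<open>p\<close>.\<close>

definition sort_upto :: "(nat \<Rightarrow> nat) \<Rightarrow> nat \<Rightarrow> nat \<Rightarrow> nat \<Rightarrow> nat list" where
  "sort_upto f n m p = concat (map (\<lambda>k. filter (\<lambda>j. f j = k) [0..<n]) [0..<m]) @
     filter (\<lambda>j. f j = m) [0..<p]"

lemma sort_upto_Suc: "sort_upto f n m n = sort_upto f n (Suc m) 0"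
  by (simp add: sort_upto_def)

lemma set_sort_upto: "set (sort_upto f n m p) = {j. j < n \<and> f j < m} \<union> {j. j < p \<and> f j = m}"
  by (auto simp: sort_upto_def)

lemma sort_upto_props:
  assumes "p \<le> n"
  shows "distinct (sort_upto f n m p)" and "sorted (map f (sort_upto f n m p))"
proof -
  have const: "sorted (map f (filter (\<lambda>j. f j = k) xs))" for k xs
    by (induction xs) auto
  have "distinct (sort_upto f n m 0) \<and> sorted (map f (sort_upto f n m 0))"
  proof (induction m)
    case 0
    then show ?case by (simp add: sort_upto_def)
  next
    case (Suc m)
    have "sort_upto f n (Suc m) 0 = sort_upto f n m 0 @ filter (\<lambda>j. f j = m) [0..<n]"
      by (simp add: sort_upto_def)
    then show ?case using Suc set_sort_upto[of f n m 0]
      by (auto simp: sorted_append const)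
  qed
  moreover have "sort_upto f n m p = sort_upto f n m 0 @ filter (\<lambda>j. f j = m) [0..<p]"
    by (simp add: sort_upto_def)
  ultimately show "distinct (sort_upto f n m p)" "sorted (map f (sort_upto f n m p))"
    using set_sort_upto[of f n m 0]
    by (auto simp: sorted_append const)
qed

text \<open>Guarantees that \<open>Cnt\<close>, and with it the index written in \<open>Ord\<close>,
  stays within a word.\<close>

lemma length_sort_upto:
  assumes "p \<le> n"
  shows "length (sort_upto f n m p) \<le> n"
proof -
  have "set (sort_upto f n m p) \<subseteq> {..<n}" using assms by (auto simp: set_sort_upto)
  then have "card (set (sort_upto f n m p)) \<le> n" by (metis card_lessThan card_mono finite_lessThan)
  then show ?thesis using sort_upto_props(1)[OF assms] by (simp add: distinct_card)
qed

definition listed :: "reg store \<Rightarrow> nat list \<Rightarrow> bool" where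
  "listed s l \<longleftrightarrow> s (Cnt, 0, 0) = length l \<and> (\<forall>i<length l. s (Ord, i, 0) = l ! i)"

lemma wp_sort_J:
  assumes s: "s (Num, 0, 0) = n" "s (K, 0, 0) = k" "k < n" "\<forall>j<n. s (Deg, j, 0) = f j"
    "listed s (sort_upto f n k 0)"
  shows "wp n body (FOR J BELOW \<section>Num DO
       IF Eq (Deg\<langle>\<section>J, Const 0\<rangle>) (\<section>K)
       THEN (Ord\<langle>\<section>Cnt, Const 0\<rangle> ::= \<section>J;; \<section>Cnt ::= Succ (\<section>Cnt))
       ELSE Skip) s
    (\<lambda>s' out t d. out = [] \<and> t \<le> 12 + n * 65 \<and> d = 0 \<and> listed s' (sort_upto f n k n) \<and>
      (\<forall>a i j. a \<notin> {J, Ord, Cnt} \<longrightarrow> s' (a, i, j) = s (a, i, j)))"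
proof (rule wp_For_const[where T = 50 and Inv = "\<lambda>m s' out. out = [] \<and> listed s' (sort_upto f n k m) \<and>
      (\<forall>a i j. a \<notin> {J, Ord, Cnt} \<longrightarrow> s' (a, i, j) = s (a, i, j))"], goal_cases)
  case (4 m s1 out)
  have s1: "s1 (K, 0, 0) = k" "s1 (Deg, m, 0) = f m" using 4 s by auto
  have len: "length (sort_upto f n k (Suc m)) \<le> n" "length (sort_upto f n k m) \<le> n"
    using 4(1) by (simp_all add: length_sort_upto)
  have app: "sort_upto f n k (Suc m) = sort_upto f n k m @ (if f m = k then [m] else [])"
    by (simp add: sort_upto_def)
  show ?case using 4 s1 len unfolding app
    by (auto simp: wp_simps listed_def nth_append less_Suc_eq)
qed (use s in \<open>auto simp: listed_def\<close>)

lemma wp_step2: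
  assumes s: "s (Num, 0, 0) = n"
  shows "wp n body step2 s (\<lambda>s' out t d. out = [] \<and>
      t \<le> 100 + n * (100 + n * 120) \<and> d = 0 \<and> s' (Num, 0, 0) = n \<and>
      (\<forall>i j. s' (Adj, i, j) = s (Adj, i, j)) \<and> listed s' (sort_upto (indeg n s) n n 0))"
  unfolding step2_def wp_Seq
proof (rule wp_mono[OF wp_degrees[where s = s, OF s]], goal_cases)
  case (1 s1 o1 t1 d1)
  let ?s = "s1((Cnt, 0, 0) := 0)" and ?f = "indeg n s"
  have "wp n body (FOR K BELOW \<section>Num DO FOR J BELOW \<section>Num DO
       IF Eq (Deg\<langle>\<section>J, Const 0\<rangle>) (\<section>K)
       THEN (Ord\<langle>\<section>Cnt, Const 0\<rangle> ::= \<section>J;; \<section>Cnt ::= Succ (\<section>Cnt))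
       ELSE Skip) ?s (\<lambda>s' out t d. out = [] \<and> t \<le> 12 + n * (12 + n * 65 + 15) \<and> d = 0 \<and>
         s' (Num, 0, 0) = n \<and> listed s' (sort_upto ?f n n 0) \<and>
         (\<forall>a i j. a \<in> {Adj, Deg} \<longrightarrow> s' (a, i, j) = ?s (a, i, j)))"
  proof (rule wp_For_const[where T = "12 + n * 65" and Inv = "\<lambda>m s' out. out = [] \<and>
        listed s' (sort_upto ?f n m 0) \<and> (\<forall>a i j. a \<in> {Adj, Deg} \<longrightarrow> s' (a, i, j) = ?s (a, i, j))"], goal_cases)
    case (4 m s2 out)
    show ?case
      by (rule wp_mono[OF wp_sort_J[where k = m and f = ?f]])
        (use 4 1 in \<open>auto simp: sort_upto_Suc listed_def\<close>)
  qed (use 1 in \<open>auto simp: listed_def sort_upto_def\<close>)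
  then show ?case
    unfolding wp_Assign
    by (simp, elim wp_mono) (use 1 in \<open>auto simp: algebra_simps\<close>)
qed

section \<open>The main program\<close>

lemma nth_mem_drop_iff:
  assumes "distinct vs" "i < length vs"
  shows "vs ! i \<in> set (drop k vs) \<longleftrightarrow> k \<le> i"
proof
  assume "vs ! i \<in> set (drop k vs)"
  then obtain m where "m < length vs - k" "vs ! (k + m) = vs ! i" by (auto simp: in_set_conv_nth)
  then have "k + m = i" using assms by (simp add: nth_eq_iff_index_eq)
  then show "k \<le> i" by simp
next
  assume "k \<le> i"
  then have "drop k vs ! (i - k) = vs ! i" "i - k < length (drop k vs)" using assms by auto
  then show "vs ! i \<in> set (drop k vs)" by (metis nth_mem)
qed

context subroutine begin

lemma wp_init:
  assumes s: "env s" "s (S, 0, 0) = k" "k < n"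
  shows "wp n body (FOR I BELOW \<section>Num DO
        (ArrX\<langle>Const 0, \<section>I\<rangle> ::= Eq (\<section>I) (\<section>S);;
         ArrY\<langle>Const 0, \<section>I\<rangle> ::= Less (\<section>S) (\<section>I);;
         ArrA\<langle>Const 0, \<section>I\<rangle> ::= And (ArrY\<langle>Const 0, \<section>I\<rangle>) (ord_arc (\<section>S) (\<section>I));;
         ArrB\<langle>Const 0, \<section>I\<rangle> ::= And (ArrY\<langle>Const 0, \<section>I\<rangle>) (ord_arc (\<section>I) (\<section>S)))) s
    (\<lambda>s' out t d. out = [] \<and> t \<le> 12 + n * 215 \<and> d = 0 \<and> keep 0 s s' \<and>
      rows s' 0 {vs ! k} (set (drop (Suc k) vs)))"
proof (rule wp_For_const[where T = 200 and Inv = "\<lambda>m s' out. out = [] \<and> keep 0 s s' \<and>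
      (\<forall>i<m. (s' (ArrX, 0, i) \<noteq> 0 \<longleftrightarrow> i = k) \<and> (s' (ArrY, 0, i) \<noteq> 0 \<longleftrightarrow> k < i) \<and>
        (s' (ArrA, 0, i) \<noteq> 0 \<longleftrightarrow> k < i \<and> (vs ! k, vs ! i) \<in> parcs T) \<and>
        (s' (ArrB, 0, i) \<noteq> 0 \<longleftrightarrow> k < i \<and> (vs ! i, vs ! k) \<in> parcs T))"], goal_cases)
  case (4 m s1 out)
  have k: "keep 0 s s1" using 4 by simp
  have e: "env s1" using env_keep[OF k s(1)] .
  have "s1 (S, 0, 0) = k" using keepD[OF k, of S] s(2) by simp
  moreover have "s1 (Ord, k, 0) = pos k" "s1 (Ord, m, 0) = pos m" using e s(3) 4(1) by (auto simp: env_def)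
  moreover have "0 < s1 (Adj, pos k, pos m) \<longleftrightarrow> (vs ! k, vs ! m) \<in> parcs T"
    "0 < s1 (Adj, pos m, pos k) \<longleftrightarrow> (vs ! m, vs ! k) \<in> parcs T"
    using e s(3) 4(1) unfolding env_def by simp_all
  moreover have "pos k \<le> n" "pos m \<le> n" using pos[OF s(3)] pos[OF 4(1)] by auto
  moreover have "of_bool b \<le> n" for b using s(3) by (cases b) auto
  ultimately show ?case using 4 s(3)
    by (simp add: wp_Seq wp_Assign keep_upd less_Suc_eq del: of_bool_less_eq_iff)
next
  case (5 s1 out t)
  have dist: "distinct vs" using ordering by (simp add: acyclic_ordering_def)
  have "rows s1 0 {vs ! k} (set (drop (Suc k) vs))"
    unfolding rows_def
  proof (intro allI impI)
    fix i assume i: "i < n"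
    have "vs ! i \<in> set (drop (Suc k) vs) \<longleftrightarrow> k < i" "vs ! i = vs ! k \<longleftrightarrow> i = k"
      using nth_mem_drop_iff[OF dist, of i "Suc k"] dist i s(3) n by (auto simp: nth_eq_iff_index_eq)
    then show "(s1 (ArrX, 0, i) \<noteq> 0 \<longleftrightarrow> vs ! i \<in> {vs ! k}) \<and>
      (s1 (ArrY, 0, i) \<noteq> 0 \<longleftrightarrow> vs ! i \<in> set (drop (Suc k) vs)) \<and>
      (s1 (ArrA, 0, i) \<noteq> 0 \<longleftrightarrow> vs ! i \<in> out_nbrs_set T {vs ! k} \<inter> set (drop (Suc k) vs)) \<and>
      (s1 (ArrB, 0, i) \<noteq> 0 \<longleftrightarrow> vs ! i \<in> in_nbrs_set T {vs ! k} \<inter> set (drop (Suc k) vs))"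
      using 5 i by (auto simp: out_nbrs_set_Image in_nbrs_set_Image)
  qed
  then show ?case using 5 by simp
qed (use s in \<open>auto simp: env_def keep_upd\<close>)

text \<open>Each start vertex costs at most \<open>500 * n\<close> beyond its call, and the calls
  are charged to their outputs by \<open>wp_B\<close>. The depth is at most \<open>n\<close> because
  fewer than \<open>n\<close> vertices follow the start vertex.\<close>

lemma wp_step3:
  assumes s: "env s" and T: "irrefl (parcs T)" "parcs T \<subseteq> pverts T \<times> pverts T"
  defines "outs \<equiv> concat (map (\<lambda>i. alg_B T vs {vs ! i} (set (drop (Suc i) vs))) [0..<n])"
  shows "wp n subroutine_B step3 s (\<lambda>s' out t d. out = printed (map enc outs) \<and>
    t \<le> 12 + 500 * n * n + 4000 * n * length outs \<and> d \<le> n)"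
proof -
  let ?outs = "\<lambda>k. concat (map (\<lambda>i. alg_B T vs {vs ! i} (set (drop (Suc i) vs))) [0..<k])"
  have num: "s (Num, 0, 0) = n" using s by (simp add: env_def)
  show ?thesis unfolding step3_def
  proof (rule wp_For[where Inv = "\<lambda>k s out t d. env s \<and> out = printed (map enc (?outs k)) \<and>
        t \<le> 4 + 500 * n * k + 4000 * n * length (?outs k) \<and> d \<le> n"], goal_cases)
    case (4 k s1 out t d)
    let ?s = "s1((Lev, 0, 0) := 0)"
    let ?X = "{vs ! k}" and ?Y = "set (drop (Suc k) vs)"
    have e: "env ?s" "?s (S, 0, 0) = k" using 4 by (auto simp: env_def)
    have Y: "?Y \<subseteq> set vs" by (rule set_drop_subset)
    have card: "card ?Y < n" using card_length[of "drop (Suc k) vs"] 4(1) n by simp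
    have inv: "B_inv (parcs T) ?X ?Y" using B_inv_suffix[OF T(1) trans ordering T(2)] 4(1) n by simp
    have "wp n subroutine_B (\<section>Lev ::= Const 0) s1 (\<lambda>s' out t d. s' = ?s \<and> out = [] \<and> t = 4 \<and> d = 0)"
      by (simp add: wp_Assign)
    then show ?case unfolding wp_Seq
    proof (rule wp_mono, goal_cases)
      case (1 s2 o2 t2 d2)
      then have s2: "env s2" "s2 (S, 0, 0) = k" using e by auto
      show ?case
      proof (rule wp_mono[OF wp_init[OF s2 4(1)]], goal_cases)
        case (1 s3 o3 t3 d3)
        have "keep 0 s2 s3" using 1 by simp
        then have L: "s3 (Lev, 0, 0) = 0" using keepD[of 0 s2 s3 Lev 0 0] \<open>s2 = ?s \<and> _\<close> by fastforce
        have e3: "env s3" "rows s3 0 ?X ?Y" using 1 env_keep[OF _ s2(1)] by auto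
        show ?case
        proof (rule wp_mono[OF wp_B[OF inv Y e3 L]], goal_cases)
          case (2 s4 o4 t4 d4)
          have S4: "s4 (S, 0, 0) = k" "env s4"
            using 2 keepD[of 0 s3 s4 S] keepD[of 0 s2 s3 S] 1 s2 env_keep[of 0 s3 s4] e3 by auto
          have "env (s4((S, 0, 0) := Suc k))" "s4 (Num, 0, 0) = n" using S4 by (auto simp: env_def)
          moreover have "t + (t2 + t3 + t4) + 15 \<le> 4 + 500 * n * Suc k + 4000 * n * length (?outs (Suc k))"
            using 2 1 4 \<open>s2 = ?s \<and> _\<close> by (simp add: algebra_simps)
          ultimately show ?case using 1 2 4 S4 \<open>s2 = ?s \<and> _\<close> card by (simp add: printed_append)
        qed (use card in simp)
      qed
    qed
  qed (use num s in \<open>auto simp: env_def printed_def outs_def algebra_simps\<close>)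
qed

lemma enc_decode:
  assumes "\<And>i. i < n \<Longrightarrow> us ! pos i = vs ! i" "X \<subseteq> set vs"
  shows "(!) us ` set (enc X) = X"
proof -
  have "(!) us ` set (enc X) = (!) vs ` {i. i < n \<and> vs ! i \<in> X}"
    using assms(1) by (auto simp: enc_def image_image intro!: image_cong)
  also have "\<dots> = X" using assms(2) n by (auto simp: in_set_conv_nth image_iff subset_iff)
  finally show ?thesis .
qed

end

section \<open>Assembling the time and space bounds\<close>

lemma card_grid: "card (grid w :: reg cell set) = 15 * (w + 1)\<^sup>2"
proof -
  have U: "(UNIV :: reg set) =
      {Num, Adj, Deg, Ord, Cnt, Lev, ArrX, ArrY, ArrA, ArrB, ArrV, I, J, K, S}"
    using reg.exhaust by blast
  have "card (UNIV :: reg set) = 15" unfolding U by simp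
  then show ?thesis unfolding grid_def by (simp add: card_cartesian_product power2_eq_square)
qed

lemma finite_grid: "finite (grid w :: reg cell set)"
  by (rule card_ge_0_finite) (simp add: card_grid)

text \<open>The ordering is found by the program rather than supplied: \<open>vs\<close> lists the
  vertices \<open>us ! j\<close> in the order in which the sort stores their numbers
  \<open>j\<close>.\<close>

lemma algorithm_A_run_bounds:
  assumes D: "acyclic_digraph D" and conn: "Digraph_Component.connected (with_proj D)"
    and us: "distinct us" "set us = pverts D"
  defines "n \<equiv> length us"
  shows "\<exists>vs t m. acyclic_ordering (TC D) vs \<and> algorithm_A_run D us (alg_A D vs) t m \<and>
    t \<le> 10000 * (n * cc D) \<and> m \<le> 10000 * n\<^sup>2"
proof -
  let ?r = "parcs (TC D)"
  note irr = irrefl_TC[OF D] and tr = trans_TC[OF D] and wf = TC_wf[OF D]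
  have card_n: "n = card (pverts D)" using us distinct_card n_def by metis
  have "pverts D \<noteq> {}"
    using cc_rel_pverts[OF D conn] by (simp add: cc_rel_def link_connected_def)
  then have n1: "1 \<le> n" unfolding n_def using us by (cases us) auto
  let ?s = "input D us"
  have num: "?s (Num, 0, 0) = n" by (simp add: input_def n_def)
  have "parcs D \<subseteq> pverts D \<times> pverts D"
    using wf by (auto simp: parcs_TC pverts_TC)
  then have W: "warshall (adj ?s) n i j \<longleftrightarrow> (us ! i, us ! j) \<in> ?r" if "i < n" "j < n" for i j
    unfolding parcs_TC n_def
    by (intro warshall_trancl[OF us(2)]) (use that us(1) in \<open>auto simp: n_def input_def\<close>)
  define deg where "deg j = length (filter (\<lambda>i. (us ! i, us ! j) \<in> ?r) [0..<n])" for j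
  have deg_card: "deg j = card {i. i < n \<and> (us ! i, us ! j) \<in> ?r}" for j
    unfolding deg_def by (subst distinct_length_filter) (auto intro!: arg_cong[of _ _ card])
  \<comment> \<open>By transitivity each in-neighbour of \<open>us ! i\<close> is one of
    \<open>us ! j\<close>, and \<open>us ! i\<close> itself is an additional one. Hence sorting by
    in-degree respects all arcs.\<close>
  have deg_mono: "deg i < deg j" if "(us ! i, us ! j) \<in> ?r" "i < n" for i j
    unfolding deg_card
    using that irr tr by (intro psubset_card_mono) (auto simp: irrefl_def dest: transD)
  \<comment> \<open>No vertex is its own in-neighbour, so every degree is below \<open>n\<close>.
    The sort only looks for keys below \<open>n\<close> and therefore misses no vertex.\<close>
  have deg_lt: "deg j < n" if "j < n" for j
  proof -
    have "{i. i < n \<and> (us ! i, us ! j) \<in> ?r} \<subset> {..<n}" using irr that by (auto simp: irrefl_def)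
    then show ?thesis unfolding deg_card using psubset_card_mono[of "{..<n}"] by simp
  qed
  define l where "l = sort_upto deg n n 0"
  have l: "distinct l" "sorted (map deg l)" "set l = {..<n}"
    unfolding l_def using sort_upto_props[of 0 n] deg_lt by (auto simp: set_sort_upto)
  then have len: "length l = n" by (metis card_lessThan distinct_card)
  have ln: "l ! i < n" if "i < n" for i using l(3) len that nth_mem[of i l] by auto
  define vs where "vs = map ((!) us) l"
  have "inj_on ((!) us) {..<n}" using us(1) by (simp add: inj_on_nth n_def)
  moreover have "(!) us ` {..<n} = set us" by (auto simp: n_def in_set_conv_nth image_iff)
  ultimately have ordering: "acyclic_ordering (TC D) vs"
    unfolding acyclic_ordering_def vs_def
  proof (intro conjI allI impI, goal_cases)
    case (3 i j)
    then have "deg (l ! i) < deg (l ! j)" using deg_mono ln len by simp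
    then show ?case using sorted_nth_mono[OF l(2), of j i] 3 by (simp, meson leD leI)
  qed (use l us in \<open>auto simp: distinct_map pverts_TC\<close>)
  interpret subroutine "TC D" vs "(!) l" n
    by unfold_locales (use tr ordering len ln in \<open>auto simp: vs_def\<close>)
  have outs: "concat (map (\<lambda>i. alg_B (TC D) vs {vs ! i} (set (drop (Suc i) vs))) [0..<n]) = alg_A D vs"
    using len by (simp add: alg_A_def vs_def)
  have "wp n subroutine_B algorithm_A ?s (\<lambda>s' out t d. out = printed (map enc (alg_A D vs)) \<and>
      t \<le> 12 + n * (12 + n * (12 + n * 45 + 15) + 15) + (100 + n * (100 + n * 120)) +
        (12 + 500 * n * n + 4000 * n * length (alg_A D vs)) \<and> d \<le> n)"
    unfolding algorithm_A_def wp_Seq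
  proof (rule wp_mono[OF wp_step1[where s = ?s, OF num]], goal_cases)
    case (1 s1 o1 t1 d1)
    then have s1: "s1 (Num, 0, 0) = n" "\<And>i j. i < n \<Longrightarrow> j < n \<Longrightarrow> adj s1 i j \<longleftrightarrow> (us ! i, us ! j) \<in> ?r"
      using W by auto
    have sort: "sort_upto (indeg n s1) n n 0 = l"
    proof -
      have "indeg n s1 j = deg j" if "j < n" for j
        unfolding indeg_def deg_def using s1(2) that by (intro arg_cong[of _ _ length] filter_cong) auto
      then show ?thesis unfolding l_def sort_upto_def
        by (auto intro!: arg_cong[of _ _ concat] filter_cong)
    qed
    show ?case
    proof (rule wp_mono[OF wp_step2[where s = s1, OF s1(1)]], goal_cases)
      case (1 s2 o2 t2 d2)
      have "listed s2 l" using 1 sort by simp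
      then have "s2 (Ord, i, 0) = l ! i" if "i < n" for i using that len by (simp add: listed_def)
      then have "env s2"
        unfolding env_def using 1 s1(2) ln len by (auto simp: vs_def)
      from wp_step3[OF this irr wf] show ?case
        by (rule wp_mono) (use 1 \<open>o1 = [] \<and> _\<close> outs in auto)
    qed
  qed
  then obtain s' out t U d where ex: "exec n subroutine_B algorithm_A ?s s' out t U d"
    and U: "U \<subseteq> grid n" and out: "out = printed (map enc (alg_A D vs))" and d: "d \<le> n"
    and t: "t \<le> 12 + n * (12 + n * (12 + n * 45 + 15) + 15) + (100 + n * (100 + n * 120)) +
        (12 + 500 * n * n + 4000 * n * length (alg_A D vs))"
    unfolding wp_def by auto
  have A: "distinct (alg_A D vs)" "set (alg_A D vs) = cc_sets D" using alg_A_correct[OF D ordering] .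
  then have lenA: "length (alg_A D vs) = cc D" by (metis cc_def distinct_card)
  have "alg_A D vs = map (\<lambda>l. (!) us ` set l) (map enc (alg_A D vs))"
  proof -
    have "(!) us ` set (enc X) = X" if "X \<in> set (alg_A D vs)" for X
    proof (rule enc_decode)
      show "X \<subseteq> set vs"
        using that A(2) ordering by (auto simp: cc_sets_def acyclic_ordering_def pverts_TC)
    qed (simp add: vs_def len)
    then show ?thesis by (simp add: map_idI)
  qed
  then have "algorithm_A_run D us (alg_A D vs) t (card U + d)"
    unfolding algorithm_A_run_def n_def[symmetric] using ex[unfolded out] by blast
  moreover have "t \<le> 10000 * (n * cc D)"
  proof -
    have q: "n * n \<le> 2 * cc D" using cc_ge[OF D conn] by (simp add: card_n power2_eq_square)
    have c: "n * (n * n) \<le> 2 * (n * cc D)" using mult_le_mono2[OF q, of n] by (simp add: algebra_simps)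
    \<comment> \<open>With \<open>n \<ge> 1\<close> the terms other than the last add up to at most
      \<open>943 * n ^ 3\<close>, and \<open>n ^ 3\<close> is at most \<open>2 * n * cc D\<close>.
      Together with \<open>4000 * (n * cc D)\<close> this is at most
      \<open>5886 * (n * cc D)\<close>.\<close>
    have "n \<le> n * n" "n * n \<le> n * (n * n)" using n1 by auto
    moreover have "t \<le> 124 + n * 127 + 27 * (n * n) + 45 * (n * (n * n)) + 120 * (n * n) + 500 * (n * n)
        + 4000 * (n * cc D)" using t lenA by (simp add: algebra_simps)
    ultimately show ?thesis using c n1 by linarith
  qed
  moreover have "card U + d \<le> 10000 * n\<^sup>2"
  proof -
    have "card U \<le> 15 * (n + 1)\<^sup>2" using card_mono[OF finite_grid U] by (simp add: card_grid)
    also have "\<dots> \<le> 15 * (2 * n)\<^sup>2" using n1 by (intro mult_le_mono2 power_mono) auto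
    finally have "card U \<le> 60 * n\<^sup>2" by (simp add: power2_eq_square)
    moreover have "n \<le> n\<^sup>2" using n1 by (simp add: power2_eq_square)
    ultimately show ?thesis using d by linarith
  qed
  ultimately show ?thesis using ordering by blast
qed

theorem theorem7:
  shows "(\<forall>(D :: 'a pair_pre_digraph) vs.
            acyclic_digraph D \<and> Digraph_Component.connected (with_proj D) \<and>
            acyclic_ordering (TC D) vs \<longrightarrow>
            distinct (alg_A D vs) \<and> set (alg_A D vs) = cc_sets D) \<and>
         (\<exists>c :: nat. \<forall>(D :: 'a pair_pre_digraph) us n.
            acyclic_digraph D \<and> Digraph_Component.connected (with_proj D) \<and>
            card (pverts D) = n \<and> distinct us \<and> set us = pverts D \<longrightarrow>
            (\<exists>vs t m. acyclic_ordering (TC D) vs \<and>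
               algorithm_A_run D us (alg_A D vs) t m \<and>
               t \<le> c * (n * cc D) \<and> m \<le> c * n\<^sup>2))"
proof (intro conjI allI impI exI[of _ 10000])
  fix D :: "'a pair_pre_digraph" and us n
  assume "acyclic_digraph D \<and> Digraph_Component.connected (with_proj D) \<and>
    card (pverts D) = n \<and> distinct us \<and> set us = pverts D"
  then show "\<exists>vs t m. acyclic_ordering (TC D) vs \<and> algorithm_A_run D us (alg_A D vs) t m \<and>
      t \<le> 10000 * (n * cc D) \<and> m \<le> 10000 * n\<^sup>2"
    using algorithm_A_run_bounds[of D us] distinct_card[of us] by auto
qed (simp_all add: alg_A_correct)

end
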